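(* Let $m\ge0$ be an integer and let $\delta$ be the Dirac distribution at $0$. (a) Let $n\ge1$. Then $\delta^{(m)}\in\mathcal A_r^n$ if and only if $n=m+1$. (b) For no $n\ge1$ is $\delta^{(m)}\in\mathcal A_c^n$. (c) $\|\delta^{(m)}\|_{a,m+1}=1$. (d) Let $\mu$ be a finite signed Borel measure on $\mathbb R$. Then $D^m\mu\in\mathcal A_r^{m+1}$.
   Context: Write $\overline{\mathbb R}=[-\infty,\infty]$. A function $F:\overline{\mathbb R}\to\mathbb R$ is regulated if the one-sided limits $F(x-),F(x+)$ exist in $\mathbb R$ for every $x\in\mathbb R$ and the limits $\lim_{x\to\pm\infty}F(x)$ exist in $\mathbb R$; by convention $F(\pm\infty)$ equals these limits. $\mathcal B_r$ is the space of regulated $F$ with $F(-\infty)=0$ and $F(x)=F(x-)$ for all $x\in\mathbb R$. $\mathcal B_c$ is the space of continuous functions $F:\overline{\mathbb R}\to\mathbb R$ with $F(-\infty)=0$. $\|F\|_\infty=\sup_{x\in\mathbb R}|F(x)|$. $\mathcal D'(\mathbb R)$ is the space of distributions on $\mathbb R$, and $F^{(n)}=D^nF$ is the distributional derivative. For $n\in\mathbb N=\{1,2,\dots\}$, $\mathcal A_r^n=\{f\in\mathcal D'(\mathbb R): f=F^{(n)}\text{ for some }F\in\mathcal B_r\}$ and $\mathcal A_c^n=\{f\in\mathcal D'(\mathbb R): f=F^{(n)}\text{ for some }F\in\mathcal B_c\}$; the function $F$ is unique (the primitive of $f$) and $\|f\|_{a,n}=\|F\|_\infty$. A finite signed Borel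 measure $\mu$ is identified with the distribution $\phi\mapsto\int_{\mathbb R}\phi\,d\mu$. *)

theory Defs
  imports "HOL-Analysis.Analysis"
begin

section \<open>Distributions on the real line\<close>

definition test_functions :: "(real \<Rightarrow> real) set" where
  "test_functions =
     {\<phi>. (\<forall>k x. (deriv ^^ k) \<phi> field_differentiable at x) \<and> compact (closure {x. \<phi> x \<noteq> 0})}"

definition test_converges :: "(nat \<Rightarrow> real \<Rightarrow> real) \<Rightarrow> (real \<Rightarrow> real) \<Rightarrow> bool" where
  "test_converges \<phi> \<psi> \<longleftrightarrow>
     (\<exists>K. compact K \<and> (\<forall>j. {x. \<phi> j x \<noteq> 0} \<subseteq> K)) \<and>
     (\<forall>k. uniform_limit UNIV (\<lambda>j. (deriv ^^ k) (\<phi> j)) ((deriv ^^ k) \<psi>) sequentially)"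

text \<open>
  A distribution is a linear functional on the test functions that is sequentially continuous;
  for linear functionals this is the same as continuity for the usual LF topology.
  Functionals are \<^const>\<open>extensional\<close>, that is, \<^const>\<open>undefined\<close> off the test functions, so that
  HOL equality is equality of distributions.
\<close>

definition distributions :: "((real \<Rightarrow> real) \<Rightarrow> real) set" where
  "distributions =
     {T \<in> extensional test_functions.
        (\<forall>\<phi>\<in>test_functions. \<forall>\<psi>\<in>test_functions. \<forall>a b.
           T (\<lambda>x. a * \<phi> x + b * \<psi> x) = a * T \<phi> + b * T \<psi>) \<and>
        (\<forall>\<phi> \<psi>. (\<forall>j. \<phi> j \<in> test_functions) \<longrightarrow> \<psi> \<in> test_functions \<longrightarrow>
           test_converges \<phi> \<psi> \<longrightarrow> (\<lambda>j. T (\<phi> j)) \<longlonglongrightarrow> T \<psi>)}"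

definition dist_deriv :: "((real \<Rightarrow> real) \<Rightarrow> real) \<Rightarrow> (real \<Rightarrow> real) \<Rightarrow> real" where
  "dist_deriv T = (\<lambda>\<phi>\<in>test_functions. - T (deriv \<phi>))"

definition dist_of_fun :: "(real \<Rightarrow> real) \<Rightarrow> (real \<Rightarrow> real) \<Rightarrow> real" where
  "dist_of_fun F = (\<lambda>\<phi>\<in>test_functions. LINT x|lborel. F x * \<phi> x)"

definition dirac :: "(real \<Rightarrow> real) \<Rightarrow> real" where
  "dirac = (\<lambda>\<phi>\<in>test_functions. \<phi> 0)"

section \<open>Finite signed Borel measures\<close>

definition finite_signed_borel_measure :: "(real set \<Rightarrow> real) \<Rightarrow> bool" where
  "finite_signed_borel_measure \<mu> \<longleftrightarrow>
     \<mu> {} = 0 \<and>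
     (\<forall>A :: nat \<Rightarrow> real set. range A \<subseteq> sets borel \<longrightarrow> disjoint_family A \<longrightarrow>
        (\<lambda>i. \<mu> (A i)) sums \<mu> (\<Union>i. A i))"

text \<open>
  The positive part of the Jordan decomposition, as the upper variation of \<open>\<mu>\<close>. Negative values
  of \<open>\<mu> B\<close> are truncated to 0 by \<^const>\<open>ennreal\<close>, which is harmless as \<open>B = {}\<close> contributes 0.
\<close>

definition pos_part_measure :: "(real set \<Rightarrow> real) \<Rightarrow> real measure" where
  "pos_part_measure \<mu> =
     measure_of UNIV (sets borel) (\<lambda>A. SUP B\<in>{B \<in> sets borel. B \<subseteq> A}. ennreal (\<mu> B))"

definition neg_part_measure :: "(real set \<Rightarrow> real) \<Rightarrow> real measure" where
  "neg_part_measure \<mu> = pos_part_measure (\<lambda>A. - \<mu> A)"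

definition signed_integral :: "(real set \<Rightarrow> real) \<Rightarrow> (real \<Rightarrow> real) \<Rightarrow> real" where
  "signed_integral \<mu> \<phi> =
     (LINT x|pos_part_measure \<mu>. \<phi> x) - (LINT x|neg_part_measure \<mu>. \<phi> x)"

definition dist_of_measure :: "(real set \<Rightarrow> real) \<Rightarrow> (real \<Rightarrow> real) \<Rightarrow> real" where
  "dist_of_measure \<mu> = (\<lambda>\<phi>\<in>test_functions. signed_integral \<mu> \<phi>)"

section \<open>Spaces of primitives and their distributional derivatives\<close>

definition regulated :: "(ereal \<Rightarrow> real) \<Rightarrow> bool" where
  "regulated F \<longleftrightarrow>
     (\<forall>x::real. (\<exists>l. ((\<lambda>t. F (ereal t)) \<longlongrightarrow> l) (at_left x)) \<and>
                (\<exists>l. ((\<lambda>t. F (ereal t)) \<longlongrightarrow> l) (at_right x))) \<and>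
     ((\<lambda>t. F (ereal t)) \<longlongrightarrow> F (-\<infinity>)) at_bot \<and>
     ((\<lambda>t. F (ereal t)) \<longlongrightarrow> F \<infinity>) at_top"

definition B_r :: "(ereal \<Rightarrow> real) set" where
  "B_r = {F. regulated F \<and> F (-\<infinity>) = 0 \<and>
             (\<forall>x::real. ((\<lambda>t. F (ereal t)) \<longlongrightarrow> F (ereal x)) (at_left x))}"

definition B_c :: "(ereal \<Rightarrow> real) set" where
  "B_c = {F. continuous_on UNIV F \<and> F (-\<infinity>) = 0}"

definition sup_norm :: "(ereal \<Rightarrow> real) \<Rightarrow> real" where
  "sup_norm F = (SUP x::real. \<bar>F (ereal x)\<bar>)"

definition nth_dist_deriv :: "nat \<Rightarrow> (ereal \<Rightarrow> real) \<Rightarrow> (real \<Rightarrow> real) \<Rightarrow> real" where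
  "nth_dist_deriv n F = (dist_deriv ^^ n) (dist_of_fun (\<lambda>x. F (ereal x)))"

definition A_r :: "nat \<Rightarrow> ((real \<Rightarrow> real) \<Rightarrow> real) set" where
  "A_r n = {f \<in> distributions. \<exists>F\<in>B_r. f = nth_dist_deriv n F}"

definition A_c :: "nat \<Rightarrow> ((real \<Rightarrow> real) \<Rightarrow> real) set" where
  "A_c n = {f \<in> distributions. \<exists>F\<in>B_c. f = nth_dist_deriv n F}"

text \<open>
  As \<open>B_c \<subseteq> B_r\<close>, the primitive in \<open>B_r\<close> also serves the elements of \<open>A_c n\<close>.
\<close>

definition primitive :: "nat \<Rightarrow> ((real \<Rightarrow> real) \<Rightarrow> real) \<Rightarrow> ereal \<Rightarrow> real" where
  "primitive n f = (THE F. F \<in> B_r \<and> f = nth_dist_deriv n F)"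

definition norm_a :: "nat \<Rightarrow> ((real \<Rightarrow> real) \<Rightarrow> real) \<Rightarrow> real" where
  "norm_a n f = sup_norm (primitive n f)"

end

theory Submission
  imports Defs "HOL-Probability.Distribution_Functions" "HOL-Probability.Giry_Monad"
begin

text \<open>
  A finite measure \<open>\<mu>\<close> is the derivative of its left continuous distribution function
  \<open>x \<mapsto> \<mu> {y. y < x}\<close>, by Fubini; for a signed \<open>\<mu>\<close> take the Jordan decomposition. In particular
  \<open>\<delta> = DH\<close> with the Heaviside function \<open>H\<close>, and (a), (b), (c) amount to \<open>n = m + 1\<close>, \<open>F = H\<close> being the
  only solution of \<open>F\<^sup>(\<^sup>n\<^sup>) = H\<^sup>(\<^sup>m\<^sup>+\<^sup>1\<^sup>)\<close> in \<^const>\<open>B_r\<close>. Distributions whose translates vanish at \<open>-\<infinity>\<close> are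
  determined by any of their derivatives, so the smaller of the two orders cancels. If \<open>n \<le> m\<close>, then
  \<open>\<delta>\<^sup>(\<^sup>m\<^sup>-\<^sup>n\<^sup>)\<close> would be a bounded function, which the scaling \<open>\<phi>(c x)\<close> with \<open>c\<close> large refutes. If
  \<open>n > m + 1\<close>, then \<open>H\<close> would be a derivative of a function with a limit at \<open>\<infinity>\<close>, so that its translates
  would vanish at \<open>\<infinity>\<close>, although \<open>H\<close> tends to 1 there.
\<close>

section \<open>Test functions\<close>

text \<open>Such a set \<open>S\<close> is closed under \<open>deriv\<close>, so all iterated
  derivatives of its members stay in \<open>S\<close> and are differentiable. This replaces a closed
  formula for the \<open>k\<close>-th derivative of the bump function.\<close>

lemma smooth_coinduct:
  fixes f :: "real \<Rightarrow> real"
  assumes "f \<in> S"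
    and step: "\<And>g. g \<in> S \<Longrightarrow> \<exists>g'\<in>S. \<forall>x. (g has_field_derivative g' x) (at x)"
  shows "(deriv ^^ k) f field_differentiable at x"
proof -
  have "deriv g \<in> S" if g: "g \<in> S" for g
  proof -
    obtain g' where g': "g' \<in> S" "\<forall>x. (g has_field_derivative g' x) (at x)"
      using step[OF g] by blast
    then have "deriv g = g'" by (auto intro!: ext DERIV_imp_deriv)
    with g' show ?thesis by simp
  qed
  then have "(deriv ^^ k) f \<in> S" by (induction k) (use assms(1) in auto)
  from step[OF this] show ?thesis by (auto simp: field_differentiable_def)
qed

text \<open>A closed set of reals is compact iff it is bounded, so compact support amounts to
  vanishing far out, the form in which it is used throughout.\<close>

lemma test_functions_iff:
  "\<phi> \<in> test_functions \<longleftrightarrow>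
     (\<forall>k x. (deriv ^^ k) \<phi> field_differentiable at x) \<and> (\<exists>R. \<forall>x. R < \<bar>x\<bar> \<longrightarrow> \<phi> x = 0)"
proof -
  have "compact (closure {x. \<phi> x \<noteq> 0}) \<longleftrightarrow> (\<exists>R. \<forall>x. R < \<bar>x\<bar> \<longrightarrow> \<phi> x = 0)"
    by (auto simp: bounded_iff) (meson leI less_le_not_le)+
  then show ?thesis by (simp add: test_functions_def)
qed

lemma test_support:
  assumes "\<phi> \<in> test_functions"
  obtains R where "R > 0" "\<And>x. R \<le> \<bar>x\<bar> \<Longrightarrow> \<phi> x = 0"
proof -
  obtain R where R: "\<And>x. R < \<bar>x\<bar> \<Longrightarrow> \<phi> x = 0"
    using assms unfolding test_functions_iff by blast
  show ?thesis
    by (rule that[of "\<bar>R\<bar> + 1"]) (auto intro: R)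
qed

lemma test_functionsI:
  assumes "\<And>k x. (deriv ^^ k) \<phi> field_differentiable at x" "\<And>x. R < \<bar>x\<bar> \<Longrightarrow> \<phi> x = 0"
  shows "\<phi> \<in> test_functions"
  using assms unfolding test_functions_iff by blast

lemma test_deriv_pow_DERIV:
  assumes "\<phi> \<in> test_functions"
  shows "((deriv ^^ k) \<phi> has_field_derivative (deriv ^^ Suc k) \<phi> x) (at x)"
proof -
  have "(deriv ^^ k) \<phi> field_differentiable at x" using assms by (simp add: test_functions_iff)
  then show ?thesis by (simp add: field_differentiable_derivI)
qed

lemmas test_DERIV = test_deriv_pow_DERIV[of _ 0, simplified]

lemma test_continuous: "\<phi> \<in> test_functions \<Longrightarrow> continuous_on A \<phi>"
  by (meson DERIV_isCont continuous_at_imp_continuous_on test_DERIV)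

lemma test_measurable: "\<phi> \<in> test_functions \<Longrightarrow> \<phi> \<in> borel_measurable borel"
  by (simp add: borel_measurable_continuous_onI test_continuous)

lemma deriv_eq_0_outside:
  fixes \<phi> :: "real \<Rightarrow> real"
  assumes "\<And>x. R < \<bar>x\<bar> \<Longrightarrow> \<phi> x = 0" "R < \<bar>x\<bar>"
  shows "deriv \<phi> x = 0"
proof (rule DERIV_imp_deriv)
  have "open {y::real. R < \<bar>y\<bar>}" by (intro open_Collect_less continuous_intros)
  then have "(\<phi> has_field_derivative 0) (at x) \<longleftrightarrow> ((\<lambda>_. 0) has_field_derivative 0) (at x)"
    using assms by (intro DERIV_cong_ev eventually_nhds_in_open[THEN eventually_mono]) auto
  then show "(\<phi> has_field_derivative 0) (at x)" by simp
qed

lemma test_deriv: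
  assumes "\<phi> \<in> test_functions"
  shows "deriv \<phi> \<in> test_functions"
proof -
  obtain R where R: "\<And>x. R < \<bar>x\<bar> \<Longrightarrow> \<phi> x = 0" using assms by (auto simp: test_functions_iff)
  have "(deriv ^^ k) (deriv \<phi>) field_differentiable at x" for k x
    using assms by (metis funpow_Suc_right comp_apply test_functions_iff)
  then show ?thesis
    using deriv_eq_0_outside[OF R] by (rule test_functionsI)
qed

lemma test_deriv_pow: "\<phi> \<in> test_functions \<Longrightarrow> (deriv ^^ k) \<phi> \<in> test_functions"
  by (induction k) (auto intro: test_deriv)

section \<open>Linear combinations, translates and dilations\<close>

lemma deriv_pow_linear:
  assumes "\<phi> \<in> test_functions" "\<psi> \<in> test_functions"
  shows "(deriv ^^ k) (\<lambda>x. a * \<phi> x + b * \<psi> x) = (\<lambda>x. a * (deriv ^^ k) \<phi> x + b * (deriv ^^ k) \<psi> x)"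
  by (induction k)
    (auto intro!: ext DERIV_imp_deriv derivative_eq_intros
      test_deriv_pow_DERIV[OF assms(1)] test_deriv_pow_DERIV[OF assms(2)])

lemma deriv_pow_affine:
  assumes "\<phi> \<in> test_functions"
  shows "(deriv ^^ k) (\<lambda>x. \<phi> (c * x + d)) = (\<lambda>x. c ^ k * (deriv ^^ k) \<phi> (c * x + d))"
proof (induction k)
  case (Suc k)
  have "((\<lambda>x. c ^ k * (deriv ^^ k) \<phi> (c * x + d)) has_field_derivative
          c ^ Suc k * (deriv ^^ Suc k) \<phi> (c * x + d)) (at x)" for x
    by (rule derivative_eq_intros refl DERIV_chain2[OF test_deriv_pow_DERIV[OF assms]])+ simp
  then have "deriv (\<lambda>x. c ^ k * (deriv ^^ k) \<phi> (c * x + d)) =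
      (\<lambda>x. c ^ Suc k * (deriv ^^ Suc k) \<phi> (c * x + d))"
    by (intro ext DERIV_imp_deriv)
  with Suc show ?case by simp
qed simp

lemma test_linear:
  assumes "\<phi> \<in> test_functions" "\<psi> \<in> test_functions"
  shows "(\<lambda>x. a * \<phi> x + b * \<psi> x) \<in> test_functions"
proof -
  obtain R where R: "\<And>x. R \<le> \<bar>x\<bar> \<Longrightarrow> \<phi> x = 0" using test_support[OF assms(1)] by blast
  obtain R' where R': "\<And>x. R' \<le> \<bar>x\<bar> \<Longrightarrow> \<psi> x = 0" using test_support[OF assms(2)] by blast
  have "(\<lambda>x. a * (deriv ^^ k) \<phi> x + b * (deriv ^^ k) \<psi> x) field_differentiable at x" for k x
    unfolding field_differentiable_def
    by (rule exI derivative_eq_intros refl test_deriv_pow_DERIV[OF assms(1)]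
        test_deriv_pow_DERIV[OF assms(2)])+
  moreover have "a * \<phi> x + b * \<psi> x = 0" if "max R R' < \<bar>x\<bar>" for x
    using that by (simp add: R R')
  ultimately show ?thesis
    unfolding test_functions_iff deriv_pow_linear[OF assms] by blast
qed

lemma test_affine:
  assumes "\<phi> \<in> test_functions" "c \<noteq> 0"
  shows "(\<lambda>x. \<phi> (c * x + d)) \<in> test_functions"
proof -
  obtain R where R: "R > 0" "\<And>x. R \<le> \<bar>x\<bar> \<Longrightarrow> \<phi> x = 0" using test_support[OF assms(1)] by blast
  have "(\<lambda>x. c ^ k * (deriv ^^ k) \<phi> (c * x + d)) field_differentiable at x" for k x
    unfolding field_differentiable_def
    by (rule exI derivative_eq_intros refl DERIV_chain2[OF test_deriv_pow_DERIV[OF assms(1)]])+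
  moreover have "\<phi> (c * x + d) = 0" if "(R + \<bar>d\<bar>) / \<bar>c\<bar> < \<bar>x\<bar>" for x
  proof (rule R(2))
    have "R + \<bar>d\<bar> < \<bar>c * x\<bar>" using that assms(2) by (simp add: field_simps abs_mult)
    then show "R \<le> \<bar>c * x + d\<bar>" by linarith
  qed
  ultimately show ?thesis
    unfolding test_functions_iff deriv_pow_affine[OF assms(1)] by blast
qed

lemma test_shift: "\<phi> \<in> test_functions \<Longrightarrow> (\<lambda>x. \<phi> (x + d)) \<in> test_functions"
  using test_affine[of \<phi> 1 d] by simp

lemma deriv_pow_shift:
  "\<phi> \<in> test_functions \<Longrightarrow> (deriv ^^ k) (\<lambda>x. \<phi> (x + d)) = (\<lambda>x. (deriv ^^ k) \<phi> (x + d))"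
  using deriv_pow_affine[of \<phi> k 1 d] by simp

text \<open>A test function with integral 0, such as the difference of two translates, has a test
  function as primitive. Here it is \<open>\<psi> = \<Phi> - \<Phi>(\<cdot> + t)\<close> with an
  antiderivative \<open>\<Phi>\<close> of \<open>\<phi>\<close>; \<open>\<Phi>\<close> is constant
  on either side of the support, so \<open>\<psi>\<close> vanishes far out.\<close>

lemma test_shift_difference_primitive:
  assumes "\<phi> \<in> test_functions"
  obtains \<psi> where "\<psi> \<in> test_functions" "deriv \<psi> = (\<lambda>x. \<phi> x - \<phi> (x + t))"
proof -
  obtain R where R: "R > 0" "\<And>x. R \<le> \<bar>x\<bar> \<Longrightarrow> \<phi> x = 0" using test_support[OF assms] by blast
  obtain \<Phi> where \<Phi>: "\<And>x. (\<Phi> has_field_derivative \<phi> x) (at x)"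
  proof -
    have "isCont \<phi> x" for x using test_DERIV[OF assms] DERIV_isCont by blast
    then have "\<exists>\<Phi>. \<forall>x::real. - \<infinity> < ereal x \<longrightarrow> ereal x < \<infinity> \<longrightarrow>
        (\<Phi> has_vector_derivative \<phi> x) (at x)"
      by (intro einterval_antiderivative) auto
    then show thesis using that by (auto simp: has_real_derivative_iff_has_vector_derivative)
  qed
  have const: "\<Phi> x = \<Phi> y" if "\<And>z. z \<in> closed_segment x y \<Longrightarrow> R \<le> \<bar>z\<bar>" for x y
  proof (rule has_derivative_zero_unique[of "closed_segment x y" \<Phi>])
    show "(\<Phi> has_derivative (\<lambda>h. 0)) (at z within closed_segment x y)"
      if "z \<in> closed_segment x y" for z
      using \<Phi>[of z] R(2)[OF \<open>\<And>z. z \<in> closed_segment x y \<Longrightarrow> R \<le> \<bar>z\<bar>\<close>[OF that]]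
      by (auto simp: has_field_derivative_def lambda_zero intro: has_derivative_at_withinI)
  qed auto
  define \<psi> where "\<psi> = (\<lambda>x. \<Phi> x - \<Phi> (x + t))"
  have \<psi>: "(\<psi> has_field_derivative \<phi> x - \<phi> (x + t)) (at x)" for x
    unfolding \<psi>_def by (rule derivative_eq_intros refl \<Phi> DERIV_chain2[OF \<Phi>])+ simp
  then have D: "deriv \<psi> = (\<lambda>x. \<phi> x - \<phi> (x + t))"
    by (intro ext DERIV_imp_deriv)
  have diff: "\<psi> field_differentiable at x" for x
    using \<psi> by (auto simp: field_differentiable_def)
  have D_test: "deriv \<psi> \<in> test_functions"
    using test_linear[OF assms test_shift[OF assms, of t], of 1 "-1"] by (simp add: D)
  \<comment> \<open>Derivatives of positive order are derivatives of the test function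
    \<open>deriv \<psi>\<close>; only \<open>\<psi>\<close> itself has to be treated
    separately.\<close>
  have "(deriv ^^ k) \<psi> field_differentiable at x" for k x
  proof (cases k)
    case (Suc j)
    then show ?thesis
      using D_test by (simp add: funpow_swap1 test_functions_iff del: funpow.simps)
        (simp add: funpow_Suc_right test_functions_iff del: funpow.simps)
  qed (simp add: diff)
  moreover have "\<psi> x = 0" if "R + \<bar>t\<bar> < \<bar>x\<bar>" for x
  proof -
    \<comment> \<open>Farther out than \<open>R + |t|\<close>, the segment from \<open>x\<close> to
      \<open>x + t\<close> stays on one side of the support, where \<open>\<Phi>\<close> is
      constant.\<close>
    have "R \<le> \<bar>z\<bar>" if "z \<in> closed_segment x (x + t)" for z
      using that \<open>R + \<bar>t\<bar> < \<bar>x\<bar>\<close> by (auto simp: closed_segment_eq_real_ivl split: if_splits)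
    then show ?thesis using const[of x "x + t"] by (simp add: \<psi>_def)
  qed
  ultimately have "\<psi> \<in> test_functions" by (rule test_functionsI)
  with D show thesis by (rule that[rotated])
qed

section \<open>A smooth bump function\<close>

text \<open>
  With \<open>u = 1 / (1 - x\<^sup>2)\<close>, the derivative of \<open>p(x) u\<^sup>j exp (-u)\<close> is again of this shape: since
  \<open>u' = 2 x u\<^sup>2\<close>, it suffices to expand the lower powers of \<open>u\<close> by \<open>u\<^sup>j = (1 - x\<^sup>2)\<^sup>2 u\<^sup>j\<^sup>+\<^sup>2\<close>.
\<close>

definition bump_term :: "real poly \<Rightarrow> nat \<Rightarrow> real \<Rightarrow> real" where
  "bump_term p j x =
     (if \<bar>x\<bar> < 1 then poly p x * inverse (1 - x\<^sup>2) ^ j * exp (- inverse (1 - x\<^sup>2)) else 0)"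

text \<open>Since \<open>exp u\<close> is at least the term
  \<open>u ^ (j + 2) / fact (j + 2)\<close> of its series, \<open>exp (- u)\<close> absorbs
  \<open>u ^ j\<close> and leaves two spare factors \<open>1 / u = 1 - x\<^sup>2\<close>. The
  resulting quadratic bound is what gives differentiability at the endpoints 1 and -1.\<close>

lemma bump_term_bound:
  obtains K where "\<And>x. \<bar>bump_term p j x\<bar> \<le> K * (1 - x\<^sup>2)\<^sup>2"
proof -
  have "bounded (poly p ` {-1..1})"
    by (intro compact_imp_bounded compact_continuous_image continuous_intros) auto
  then obtain B where B: "B > 0" "\<And>x. x \<in> {-1..1} \<Longrightarrow> \<bar>poly p x\<bar> \<le> B"
    by (auto simp: bounded_pos)
  have "\<bar>bump_term p j x\<bar> \<le> (B * fact (j + 2)) * (1 - x\<^sup>2)\<^sup>2" for x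
  proof (cases "\<bar>x\<bar> < 1")
    case True
    define v where "v = 1 - x\<^sup>2"
    have v: "v > 0" using True by (simp add: v_def abs_square_less_1)
    have "inverse v ^ (j + 2) / fact (j + 2) \<le> exp (inverse v)"
    proof -
      have "summable (\<lambda>n. inverse v ^ n /\<^sub>R fact n)" by (rule summable_exp_generic)
      then have "sum (\<lambda>n. inverse v ^ n /\<^sub>R fact n) {j + 2} \<le> (\<Sum>n. inverse v ^ n /\<^sub>R fact n)"
        using v by (intro sum_le_suminf) auto
      then show ?thesis by (simp add: exp_def divide_inverse_commute)
    qed
    then have "inverse v ^ (j + 2) \<le> fact (j + 2) * exp (inverse v)"
      by (simp only: pos_divide_le_eq[OF fact_gt_zero] mult.commute)
    then have "inverse v ^ (j + 2) * exp (- inverse v)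
        \<le> fact (j + 2) * exp (inverse v) * exp (- inverse v)"
      by (intro mult_right_mono) auto
    then have "inverse v ^ (j + 2) * exp (- inverse v) \<le> fact (j + 2)"
      by (simp only: mult.assoc exp_minus_inverse mult_1_right)
    then have "v\<^sup>2 * (inverse v ^ (j + 2) * exp (- inverse v)) \<le> v\<^sup>2 * fact (j + 2)"
      by (intro mult_left_mono) auto
    moreover have "v\<^sup>2 * (inverse v ^ (j + 2) * exp (- inverse v)) = inverse v ^ j * exp (- inverse v)"
      using v by (simp add: power_add power2_eq_square field_simps)
    ultimately have *: "inverse v ^ j * exp (- inverse v) \<le> fact (j + 2) * v\<^sup>2"
      by (simp only: mult.commute)
    then have "\<bar>poly p x\<bar> * (inverse v ^ j * exp (- inverse v)) \<le> B * (fact (j + 2) * v\<^sup>2)"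
      using True v B(1) by (intro mult_mono B(2) *) auto
    then show ?thesis
      using True v by (simp add: bump_term_def v_def abs_mult mult_ac)
  qed (use B in \<open>simp add: bump_term_def\<close>)
  then show thesis by (rule that)
qed

lemma bump_term_DERIV:
  "(bump_term p j has_field_derivative
     bump_term (pderiv p * [:1, 0, -1:]\<^sup>2 + [:0, 2 * of_nat j:] * p * [:1, 0, -1:] - [:0, 2:] * p) (j + 2) x)
     (at x)"
proof -
  consider "\<bar>x\<bar> < 1" | "\<bar>x\<bar> = 1" | "\<bar>x\<bar> > 1" by linarith
  then show ?thesis
  proof cases
    case 1
    define v where "v = 1 - x\<^sup>2"
    have v: "v > 0" using 1 by (simp add: v_def abs_square_less_1)
    define w where "w = inverse v"
    have vw: "v * w = 1" using v by (simp add: w_def)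
    \<comment> \<open>For \<open>j = 0\<close> the exponent \<open>j - Suc 0\<close> is truncated to
      0, but both sides carry the factor 0.\<close>
    have j: "real j * w ^ (j - Suc 0) = real j * (v * w ^ j)"
      using vw by (cases j) (auto simp: mult.assoc[symmetric])
    have w: "((\<lambda>x. inverse (1 - x\<^sup>2)) has_field_derivative 2 * x * w\<^sup>2) (at x)"
      using v by (auto intro!: derivative_eq_intros simp: v_def w_def power2_eq_square)
    have "((\<lambda>x. poly p x * inverse (1 - x\<^sup>2) ^ j * exp (- inverse (1 - x\<^sup>2))) has_field_derivative
        poly (pderiv p) x * w ^ j * exp (- w) + poly p x * (2 * x * w\<^sup>2 * (real j * w ^ (j - Suc 0))) * exp (- w)
        - poly p x * w ^ j * (2 * x * w\<^sup>2 * exp (- w))) (at x)"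
      by (rule derivative_eq_intros poly_DERIV w refl)+ (simp add: w_def v_def algebra_simps)
    also have "poly (pderiv p) x * w ^ j * exp (- w) + poly p x * (2 * x * w\<^sup>2 * (real j * w ^ (j - Suc 0))) * exp (- w)
        - poly p x * w ^ j * (2 * x * w\<^sup>2 * exp (- w)) =
        (poly (pderiv p) x * v\<^sup>2 + 2 * real j * x * poly p x * v - 2 * x * poly p x)
          * (w ^ j * w\<^sup>2) * exp (- w)"
    proof -
      have "P * W * E + Q * (2 * x * w\<^sup>2 * (J * (v * W))) * E - Q * W * (2 * x * w\<^sup>2 * E) =
          (P * v\<^sup>2 + 2 * J * x * Q * v - 2 * x * Q) * (W * w\<^sup>2) * E" for P Q W E J :: real
        using vw by algebra
      then show ?thesis unfolding j .
    qed
    finally have "((\<lambda>x. poly p x * inverse (1 - x\<^sup>2) ^ j * exp (- inverse (1 - x\<^sup>2))) has_field_derivative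
        (poly (pderiv p) x * v\<^sup>2 + 2 * real j * x * poly p x * v - 2 * x * poly p x)
          * inverse v ^ (j + 2) * exp (- inverse v)) (at x)"
      by (simp only: power_add w_def)
    moreover have "open {x::real. \<bar>x\<bar> < 1}" by (intro open_Collect_less continuous_intros)
    then have "\<forall>\<^sub>F y in nhds x. bump_term p j y =
        poly p y * inverse (1 - y\<^sup>2) ^ j * exp (- inverse (1 - y\<^sup>2))"
      using 1 by (intro eventually_nhds_in_open[THEN eventually_mono]) (auto simp: bump_term_def)
    moreover have "(poly (pderiv p) x * v\<^sup>2 + 2 * real j * x * poly p x * v - 2 * x * poly p x)
          * inverse v ^ (j + 2) * exp (- inverse v) =
        bump_term (pderiv p * [:1, 0, -1:]\<^sup>2 + [:0, 2 * of_nat j:] * p * [:1, 0, -1:] - [:0, 2:] * p)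
          (j + 2) x"
    proof -
      have "poly [:1, 0, -1:] x = v" by (simp add: v_def power2_eq_square)
      then show ?thesis
        using 1 by (simp add: bump_term_def poly_power del: poly_pCons) (simp add: v_def algebra_simps)
    qed
    ultimately show ?thesis
      by (simp only: DERIV_cong_ev[OF refl _ refl])
  next
    case 2
    \<comment> \<open>At the endpoints, \<open>1 - y\<^sup>2 = - (y - x) (y + x)\<close> turns the
      quadratic bound into one of order \<open>|y - x|\<close> for the difference quotient, on both
      sides at once.\<close>
    obtain K where K: "\<And>x. \<bar>bump_term p j x\<bar> \<le> K * (1 - x\<^sup>2)\<^sup>2" using bump_term_bound by blast
    have x2: "x\<^sup>2 = 1" using 2 by (metis one_power2 power2_abs)
    have "((\<lambda>y. (bump_term p j y - bump_term p j x) / (y - x)) \<longlongrightarrow> 0) (at x)"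
    proof (rule Lim_null_comparison)
      show "((\<lambda>y. K * \<bar>y - x\<bar> * (y + x)\<^sup>2) \<longlongrightarrow> 0) (at x)"
        by (auto intro!: tendsto_eq_intros)
      have "\<bar>bump_term p j y - bump_term p j x\<bar> / \<bar>y - x\<bar> \<le> K * \<bar>y - x\<bar> * (y + x)\<^sup>2" if "y \<noteq> x" for y
      proof -
        have "1 - y\<^sup>2 = - ((y - x) * (y + x))" using x2 by (simp add: power2_eq_square algebra_simps)
        then have "\<bar>bump_term p j y\<bar> \<le> K * (\<bar>y - x\<bar> * \<bar>y - x\<bar> * (y + x)\<^sup>2)"
          using K[of y] by (simp add: power_mult_distrib power2_eq_square mult_ac)
        moreover have "bump_term p j x = 0" using 2 by (simp add: bump_term_def)
        ultimately show ?thesis using that by (simp add: pos_divide_le_eq mult_ac)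
      qed
      then show "\<forall>\<^sub>F y in at x. norm ((bump_term p j y - bump_term p j x) / (y - x))
          \<le> K * \<bar>y - x\<bar> * (y + x)\<^sup>2"
        by (auto simp: eventually_at_filter)
    qed
    then show ?thesis using 2 by (simp add: has_field_derivative_iff bump_term_def)
  next
    case 3
    have "open {x::real. 1 < \<bar>x\<bar>}" by (intro open_Collect_less continuous_intros)
    then have "\<forall>\<^sub>F y in nhds x. bump_term p j y = 0"
      using 3 by (intro eventually_nhds_in_open[THEN eventually_mono]) (auto simp: bump_term_def)
    then show ?thesis using 3 by (simp add: DERIV_cong_ev bump_term_def[of _ _ x])
  qed
qed

text \<open>The witness \<open>bump_term 1 0\<close> is \<open>exp (- 1 / (1 - x\<^sup>2))\<close>
  on the interval from -1 to 1 and 0 elsewhere. It is smooth because derivatives of functions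
  \<open>bump_term p j\<close> are again of this form.\<close>

lemma bump_function_exists:
  obtains \<beta> :: "real \<Rightarrow> real" where "\<beta> \<in> test_functions" "\<And>x. \<beta> x \<ge> 0"
    "\<And>x. \<beta> x > 0 \<longleftrightarrow> \<bar>x\<bar> < 1"
proof
  have "(deriv ^^ k) (bump_term 1 0) field_differentiable at x" for k x
    by (rule smooth_coinduct[where S = "{bump_term p j | p j. True}"])
      (use bump_term_DERIV in blast)+
  moreover have "bump_term 1 0 x = 0" if "1 < \<bar>x\<bar>" for x using that by (simp add: bump_term_def)
  ultimately show "bump_term 1 0 \<in> test_functions" by (rule test_functionsI)
qed (auto simp: bump_term_def)

section \<open>Functionals\<close>

text \<open>The linearity clause of \<open>distributions\<close>, split off because the cancellation
  of derivatives below argues with linearity and translations.\<close>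

definition linear_functional :: "((real \<Rightarrow> real) \<Rightarrow> real) \<Rightarrow> bool" where
  "linear_functional T \<longleftrightarrow> (\<forall>\<phi>\<in>test_functions. \<forall>\<psi>\<in>test_functions. \<forall>a b.
     T (\<lambda>x. a * \<phi> x + b * \<psi> x) = a * T \<phi> + b * T \<psi>)"

lemma linear_functional_diff:
  assumes "linear_functional T" "\<phi> \<in> test_functions" "\<psi> \<in> test_functions"
  shows "T (\<lambda>x. \<phi> x - \<psi> x) = T \<phi> - T \<psi>"
proof -
  have "T (\<lambda>x. 1 * \<phi> x + (-1) * \<psi> x) = 1 * T \<phi> + (-1) * T \<psi>"
    using assms unfolding linear_functional_def by blast
  then show ?thesis by simp
qed

lemma dist_deriv_apply: "\<phi> \<in> test_functions \<Longrightarrow> dist_deriv T \<phi> = - T (deriv \<phi>)"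
  by (simp add: dist_deriv_def)

lemma dist_deriv_pow_apply:
  "\<phi> \<in> test_functions \<Longrightarrow> (dist_deriv ^^ k) T \<phi> = (-1) ^ k * T ((deriv ^^ k) \<phi>)"
proof (induction k arbitrary: \<phi>)
  case (Suc k)
  have "(deriv ^^ Suc k) \<phi> = (deriv ^^ k) (deriv \<phi>)"
    by (simp add: funpow_Suc_right del: funpow.simps)
  with Suc show ?case
    by (simp only:) (simp add: dist_deriv_apply test_deriv)
qed simp

lemma linear_functional_dist_deriv:
  assumes "linear_functional T"
  shows "linear_functional (dist_deriv T)"
  unfolding linear_functional_def
proof (intro ballI allI)
  fix \<phi> \<psi> a b assume t: "\<phi> \<in> test_functions" "\<psi> \<in> test_functions"
  have "deriv (\<lambda>x. a * \<phi> x + b * \<psi> x) = (\<lambda>x. a * deriv \<phi> x + b * deriv \<psi> x)"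
    using deriv_pow_linear[OF t, of 1] by simp
  then show "dist_deriv T (\<lambda>x. a * \<phi> x + b * \<psi> x) = a * dist_deriv T \<phi> + b * dist_deriv T \<psi>"
    using assms t
    by (simp add: dist_deriv_apply test_linear test_deriv linear_functional_def)
qed

lemma distributionsI:
  assumes "T \<in> extensional test_functions" "linear_functional T"
    and "\<And>\<phi> \<psi>. (\<And>j. \<phi> j \<in> test_functions) \<Longrightarrow> \<psi> \<in> test_functions \<Longrightarrow> test_converges \<phi> \<psi> \<Longrightarrow>
      (\<lambda>j. T (\<phi> j)) \<longlonglongrightarrow> T \<psi>"
  shows "T \<in> distributions"
proof -
  have "\<forall>\<phi> \<psi>. (\<forall>j. \<phi> j \<in> test_functions) \<longrightarrow> \<psi> \<in> test_functions \<longrightarrow>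
      test_converges \<phi> \<psi> \<longrightarrow> (\<lambda>j. T (\<phi> j)) \<longlonglongrightarrow> T \<psi>"
  proof (intro allI impI)
    fix \<phi> \<psi>
    assume "\<forall>j. \<phi> j \<in> test_functions" "\<psi> \<in> test_functions" "test_converges \<phi> \<psi>"
    then show "(\<lambda>j. T (\<phi> j)) \<longlonglongrightarrow> T \<psi>" by (intro assms(3)[of \<phi> \<psi>]) blast+
  qed
  with assms(1,2) show ?thesis
    unfolding distributions_def linear_functional_def mem_Collect_eq by (intro conjI)
qed

lemma distributions_linear: "T \<in> distributions \<Longrightarrow> linear_functional T"
  by (simp add: distributions_def linear_functional_def)

lemma distributions_tendsto:
  assumes "T \<in> distributions" "\<And>j. \<phi> j \<in> test_functions" "\<psi> \<in> test_functions" "test_converges \<phi> \<psi>"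
  shows "(\<lambda>j. T (\<phi> j)) \<longlonglongrightarrow> T \<psi>"
proof -
  have "\<forall>\<phi> \<psi>. (\<forall>j. \<phi> j \<in> test_functions) \<longrightarrow> \<psi> \<in> test_functions \<longrightarrow>
      test_converges \<phi> \<psi> \<longrightarrow> (\<lambda>j. T (\<phi> j)) \<longlonglongrightarrow> T \<psi>"
    using assms(1) unfolding distributions_def mem_Collect_eq by (rule conjunct2[OF conjunct2])
  from spec[OF spec[OF this, of \<phi>], of \<psi>] show ?thesis using assms(2-) by blast
qed

lemma dist_deriv_distributions:
  assumes T: "T \<in> distributions"
  shows "dist_deriv T \<in> distributions"
proof (rule distributionsI)
  show "dist_deriv T \<in> extensional test_functions"
    by (simp add: dist_deriv_def)
  show "linear_functional (dist_deriv T)"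
    using T by (intro linear_functional_dist_deriv distributions_linear)
  fix \<phi> \<psi>
  assume t: "\<And>j. \<phi> j \<in> test_functions" "\<psi> \<in> test_functions" and c: "test_converges \<phi> \<psi>"
  obtain K where K: "compact K" "\<And>j. {x. \<phi> j x \<noteq> 0} \<subseteq> K"
    using c unfolding test_converges_def by blast
  \<comment> \<open>Outside the closed set \<open>K\<close> each \<open>\<phi> j\<close> vanishes on
    a neighbourhood, so the derivatives are supported in the same \<open>K\<close>.\<close>
  have "{x. deriv (\<phi> j) x \<noteq> 0} \<subseteq> K" for j
  proof
    fix x assume x: "x \<in> {x. deriv (\<phi> j) x \<noteq> 0}"
    show "x \<in> K"
    proof (rule ccontr)
      assume "x \<notin> K"
      moreover have "open (- K)" using K(1) by (auto intro: compact_imp_closed)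
      ultimately have "\<forall>\<^sub>F y in nhds x. \<phi> j y = 0"
        using K(2) by (intro eventually_nhds_in_open[THEN eventually_mono]) auto
      then have "(\<phi> j has_field_derivative 0) (at x)"
        by (subst DERIV_cong_ev[where g = "\<lambda>_. 0"]) auto
      then show False using x DERIV_imp_deriv by blast
    qed
  qed
  moreover have "uniform_limit UNIV (\<lambda>j. (deriv ^^ k) (deriv (\<phi> j))) ((deriv ^^ k) (deriv \<psi>)) sequentially" for k
  proof -
    have "uniform_limit UNIV (\<lambda>j. (deriv ^^ Suc k) (\<phi> j)) ((deriv ^^ Suc k) \<psi>) sequentially"
      using c unfolding test_converges_def by blast
    then show ?thesis by (simp only: funpow_Suc_right comp_apply)
  qed
  ultimately have "test_converges (\<lambda>j. deriv (\<phi> j)) (deriv \<psi>)"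
    unfolding test_converges_def using K(1) by blast
  then have "(\<lambda>j. T (deriv (\<phi> j))) \<longlonglongrightarrow> T (deriv \<psi>)"
    using t by (intro distributions_tendsto[OF T] test_deriv)
  then show "(\<lambda>j. dist_deriv T (\<phi> j)) \<longlonglongrightarrow> dist_deriv T \<psi>"
    using t by (simp add: dist_deriv_apply tendsto_minus)
qed

lemma dist_deriv_pow_distributions: "T \<in> distributions \<Longrightarrow> (dist_deriv ^^ k) T \<in> distributions"
  by (induction k) (auto intro: dist_deriv_distributions)

text \<open>As \<open>t\<close> grows, \<open>\<phi>(\<cdot> + t)\<close> moves to minus infinity.
  Linear functionals with the same derivative differ by a multiple of the integral, and a nonzero
  multiple of the integral violates this condition.\<close>

definition vanishes_at_bot :: "((real \<Rightarrow> real) \<Rightarrow> real) \<Rightarrow> bool" where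
  "vanishes_at_bot T \<longleftrightarrow> (\<forall>\<phi>\<in>test_functions. ((\<lambda>t. T (\<lambda>x. \<phi> (x + t))) \<longlongrightarrow> 0) at_top)"

text \<open>Differentiation commutes with translation, so the condition survives repeated
  differentiation.\<close>

lemma vanishes_at_bot_dist_deriv:
  assumes "vanishes_at_bot T"
  shows "vanishes_at_bot (dist_deriv T)"
  unfolding vanishes_at_bot_def
proof
  fix \<phi> assume t: "\<phi> \<in> test_functions"
  have "deriv (\<lambda>x. \<phi> (x + t)) = (\<lambda>x. deriv \<phi> (x + t))" for t
    using deriv_pow_shift[OF t, of 1] by simp
  moreover have "((\<lambda>t. - T (\<lambda>x. deriv \<phi> (x + t))) \<longlongrightarrow> - 0) at_top"
    using assms test_deriv[OF t] unfolding vanishes_at_bot_def by (intro tendsto_minus) blast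
  ultimately show "((\<lambda>t. dist_deriv T (\<lambda>x. \<phi> (x + t))) \<longlongrightarrow> 0) at_top"
    using t by (simp add: dist_deriv_apply test_shift)
qed

lemma dist_deriv_pow_preserves:
  assumes "linear_functional T" "vanishes_at_bot T"
  shows "linear_functional ((dist_deriv ^^ k) T)" "vanishes_at_bot ((dist_deriv ^^ k) T)"
  by (induction k) (simp_all add: assms linear_functional_dist_deriv vanishes_at_bot_dist_deriv)

text \<open>
  \<open>\<phi> - \<phi>(\<cdot> + t)\<close> is the derivative of a test function, so \<open>(T - S) \<phi> = (T - S) (\<phi>(\<cdot> + t))\<close> if
  \<open>T\<close> and \<open>S\<close> have the same derivative. Let \<open>t\<close> tend to infinity.
\<close>

lemma dist_deriv_eq_imp_eq:
  assumes "linear_functional T" "linear_functional S" "vanishes_at_bot T" "vanishes_at_bot S"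
    and deriv_eq: "dist_deriv T = dist_deriv S"
  shows "\<forall>\<phi>\<in>test_functions. T \<phi> = S \<phi>"
proof
  fix \<phi> assume t: "\<phi> \<in> test_functions"
  have eq: "T (\<lambda>x. \<phi> (x + s)) - S (\<lambda>x. \<phi> (x + s)) = T \<phi> - S \<phi>" for s
  proof -
    obtain \<psi> where \<psi>: "\<psi> \<in> test_functions" "deriv \<psi> = (\<lambda>x. \<phi> x - \<phi> (x + s))"
      using test_shift_difference_primitive[OF t] by blast
    then have "T (\<lambda>x. \<phi> x - \<phi> (x + s)) = S (\<lambda>x. \<phi> x - \<phi> (x + s))"
      using dist_deriv_apply[of \<psi> T] dist_deriv_apply[of \<psi> S] deriv_eq by simp
    then show ?thesis
      using linear_functional_diff[OF assms(1) t test_shift[OF t], of s]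
        linear_functional_diff[OF assms(2) t test_shift[OF t], of s] by simp
  qed
  have "((\<lambda>s. T (\<lambda>x. \<phi> (x + s)) - S (\<lambda>x. \<phi> (x + s))) \<longlongrightarrow> 0 - 0) at_top"
    using assms(3,4) t unfolding vanishes_at_bot_def by (intro tendsto_diff) blast+
  then show "T \<phi> = S \<phi>" by (simp add: eq tendsto_const_iff)
qed

lemma dist_deriv_pow_eq_imp_eq:
  assumes "linear_functional T" "linear_functional S" "vanishes_at_bot T" "vanishes_at_bot S"
    and "(dist_deriv ^^ n) T = (dist_deriv ^^ n) S"
  shows "\<forall>\<phi>\<in>test_functions. T \<phi> = S \<phi>"
  using assms
proof (induction n arbitrary: T S)
  case 0
  then show ?case by simp
next
  case (Suc n)
  have "(dist_deriv ^^ n) (dist_deriv T) = (dist_deriv ^^ n) (dist_deriv S)"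
    using Suc.prems(5) by (simp only: funpow_Suc_right comp_apply)
  then have "\<forall>\<psi>\<in>test_functions. dist_deriv T \<psi> = dist_deriv S \<psi>"
    using linear_functional_dist_deriv Suc.prems vanishes_at_bot_dist_deriv by (intro Suc.IH) auto
  \<comment> \<open>The induction only yields agreement on test functions; \<open>dist_deriv\<close>
    is extensional by construction, which upgrades this to equality.\<close>
  then have "dist_deriv T = dist_deriv S"
    by (intro extensionalityI[of _ test_functions]) (auto simp: dist_deriv_def)
  with Suc.prems show ?case by (intro dist_deriv_eq_imp_eq)
qed

section \<open>Bounded measurable functions as distributions\<close>

lemma test_integrable:
  assumes "\<phi> \<in> test_functions"
  shows "integrable lborel \<phi>"
proof -
  obtain R where R: "R > 0" "\<And>x. R \<le> \<bar>x\<bar> \<Longrightarrow> \<phi> x = 0" using test_support[OF assms] by blast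
  have "integrable lborel (\<lambda>x. indicator {-R..R} x *\<^sub>R \<phi> x)"
    using assms by (intro borel_integrable_compact test_continuous) auto
  also have "(\<lambda>x. indicator {-R..R} x *\<^sub>R \<phi> x) = \<phi>"
  proof
    fix x show "indicator {-R..R} x *\<^sub>R \<phi> x = \<phi> x"
      using R(2)[of x] by (cases "x \<in> {-R..R}") auto
  qed
  finally show ?thesis .
qed

text \<open>The fundamental theorem of calculus up to a point beyond the support. The half-line is
  open because \<open>x \<in> {y<..}\<close>, read as a condition on \<open>y\<close>, becomes
  \<open>y \<in> {..<x}\<close>, the set that \<open>left_cdf\<close> measures.\<close>

lemma test_eq_integral_deriv:
  assumes t: "\<phi> \<in> test_functions"
  shows "\<phi> y = - (LINT x|lborel. indicator {y<..} x * deriv \<phi> x)"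
proof -
  obtain R where R: "R > 0" "\<And>x. R \<le> \<bar>x\<bar> \<Longrightarrow> \<phi> x = 0" using test_support[OF t] by blast
  \<comment> \<open>The point \<open>y\<close> may lie to the right of the support, where
    \<open>R\<close> would not do as upper limit.\<close>
  define b where "b = max R y"
  have d0: "deriv \<phi> x = 0" if "R < \<bar>x\<bar>" for x
    by (rule deriv_eq_0_outside[OF R(2) that]) simp
  have "(LINT x|lborel. deriv \<phi> x * indicator {y..b} x) = \<phi> b - \<phi> y"
    using test_DERIV[OF t] DERIV_isCont[OF test_DERIV[OF test_deriv[OF t]]]
    by (intro integral_FTC_Icc_real) (auto simp: b_def)
  moreover have "(LINT x|lborel. deriv \<phi> x * indicator {y..b} x) =
      (LINT x|lborel. indicator {y<..} x * deriv \<phi> x)"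
  proof (rule integral_cong_AE)
    show "AE x in lborel. deriv \<phi> x * indicator {y..b} x = indicator {y<..} x * deriv \<phi> x"
      using AE_lborel_singleton[of y]
      by eventually_elim (use R(1) in \<open>auto simp: b_def indicator_def intro!: d0\<close>)
  qed (use test_measurable[OF test_deriv[OF t]] in measurable)
  moreover have "\<phi> b = 0" using R by (auto simp: b_def)
  ultimately show ?thesis by simp
qed

text \<open>The previous formula at \<open>- R - 1\<close>: this point lies left of the support, so
  \<open>\<phi>\<close> vanishes there and the half-line captures the whole integral.\<close>

lemma test_integral_deriv_eq_0:
  assumes t: "\<phi> \<in> test_functions"
  shows "(LINT x|lborel. deriv \<phi> x) = 0"
proof -
  obtain R where R: "R > 0" "\<And>x. R \<le> \<bar>x\<bar> \<Longrightarrow> \<phi> x = 0" using test_support[OF t] by blast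
  have "(LINT x|lborel. deriv \<phi> x) = (LINT x|lborel. indicator {- R - 1<..} x * deriv \<phi> x)"
  proof (rule Bochner_Integration.integral_cong)
    fix x show "deriv \<phi> x = indicator {- R - 1<..} x * deriv \<phi> x"
      using R(1) deriv_eq_0_outside[of R \<phi> x, OF R(2)] by (cases "x \<in> {- R - 1<..}") auto
  qed simp
  then show ?thesis using test_eq_integral_deriv[OF t, of "- R - 1"] R by simp
qed

locale bounded_measurable =
  fixes F :: "real \<Rightarrow> real" and C :: real
  assumes meas [measurable]: "F \<in> borel_measurable borel"
    and bound: "\<And>x. \<bar>F x\<bar> \<le> C"
begin

lemma integrable_mult_test:
  assumes "\<phi> \<in> test_functions"
  shows "integrable lborel (\<lambda>x. F x * \<phi> x)"
proof (rule Bochner_Integration.integrable_bound)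
  show "integrable lborel (\<lambda>x. C * \<phi> x)" using test_integrable[OF assms] by simp
  have "C \<ge> 0" using bound[of 0] by linarith
  then show "AE x in lborel. norm (F x * \<phi> x) \<le> norm (C * \<phi> x)"
    by (auto simp: abs_mult intro!: mult_right_mono bound)
qed (use test_measurable[OF assms] in measurable)

lemma linear_functional_fun: "linear_functional (dist_of_fun F)"
  unfolding linear_functional_def
proof (intro ballI allI)
  fix \<phi> \<psi> a b assume t: "\<phi> \<in> test_functions" "\<psi> \<in> test_functions"
  have "(LINT x|lborel. F x * (a * \<phi> x + b * \<psi> x)) =
      (LINT x|lborel. a * (F x * \<phi> x) + b * (F x * \<psi> x))"
    by (simp add: algebra_simps)
  also have "\<dots> = a * (LINT x|lborel. F x * \<phi> x) + b * (LINT x|lborel. F x * \<psi> x)"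
    using integrable_mult_test t by simp
  finally show "dist_of_fun F (\<lambda>x. a * \<phi> x + b * \<psi> x) = a * dist_of_fun F \<phi> + b * dist_of_fun F \<psi>"
    using t by (simp add: dist_of_fun_def test_linear)
qed

text \<open>Dominated convergence with majorant \<open>C * |\<phi>|\<close>. The coefficients are
  general in order to cover translations to either infinity and contractions towards a point. The
  limit is required only where \<open>\<phi>\<close> is nonzero, so that a support on one side of 0
  can select a one-sided limit.\<close>

lemma integral_affine_tendsto:
  fixes a b :: "real \<Rightarrow> real"
  assumes t: "\<phi> \<in> test_functions"
    and lim: "\<And>y. \<phi> y \<noteq> 0 \<Longrightarrow> ((\<lambda>s. F (a s + b s * y)) \<longlongrightarrow> L) at_top"
  shows "((\<lambda>s. LINT y|lborel. F (a s + b s * y) * \<phi> y) \<longlongrightarrow> L * (LINT y|lborel. \<phi> y)) at_top"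
proof -
  have "((\<lambda>s. LINT y|lborel. F (a s + b s * y) * \<phi> y) \<longlongrightarrow> (LINT y|lborel. L * \<phi> y)) at_top"
  proof (rule integral_dominated_convergence_at_top)
    show "integrable lborel (\<lambda>y. C * \<bar>\<phi> y\<bar>)" using test_integrable[OF t] by simp
    show "AE y in lborel. ((\<lambda>s. F (a s + b s * y) * \<phi> y) \<longlongrightarrow> L * \<phi> y) at_top"
    proof (rule AE_I2)
      fix y show "((\<lambda>s. F (a s + b s * y) * \<phi> y) \<longlongrightarrow> L * \<phi> y) at_top"
        by (cases "\<phi> y = 0") (auto intro!: tendsto_intros lim)
    qed
    show "\<forall>\<^sub>F s in at_top. AE y in lborel. norm (F (a s + b s * y) * \<phi> y) \<le> C * \<bar>\<phi> y\<bar>"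
    proof (rule always_eventually, intro allI AE_I2)
      fix s y show "norm (F (a s + b s * y) * \<phi> y) \<le> C * \<bar>\<phi> y\<bar>"
        by (simp add: abs_mult mult_right_mono bound)
    qed
  qed (use test_measurable[OF t] in measurable)
  then show ?thesis by simp
qed

section \<open>Limits along translates and dilations of a test function\<close>

lemma dist_of_fun_shift:
  assumes t: "\<phi> \<in> test_functions"
  shows "dist_of_fun F (\<lambda>x. \<phi> (x + s)) = (LINT y|lborel. F (- s + 1 * y) * \<phi> y)"
proof -
  have "dist_of_fun F (\<lambda>x. \<phi> (x + s)) = (LINT x|lborel. F x * \<phi> (x + s))"
    using t by (simp add: dist_of_fun_def test_shift)
  also have "\<dots> = (LINT y|lborel. F (- s + 1 * y) * \<phi> y)"
    by (subst lborel_integral_real_affine[of 1 _ "-s"]) auto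
  finally show ?thesis .
qed

lemma dist_of_fun_at_bot:
  assumes "\<phi> \<in> test_functions" and "(F \<longlongrightarrow> L) at_bot"
  shows "((\<lambda>s. dist_of_fun F (\<lambda>x. \<phi> (x + s))) \<longlongrightarrow> L * (LINT y|lborel. \<phi> y)) at_top"
  unfolding dist_of_fun_shift[OF assms(1)]
proof (rule integral_affine_tendsto[OF assms(1)])
  fix y :: real
  have "filterlim (\<lambda>s. - s + 1 * y) at_bot at_top"
    unfolding filterlim_at_bot_dense eventually_at_top_dense
  proof
    fix Z show "\<exists>N. \<forall>n>N. - n + 1 * y < Z" by (intro exI[of _ "y - Z"]) auto
  qed
  then show "((\<lambda>s. F (- s + 1 * y)) \<longlongrightarrow> L) at_top" by (rule filterlim_compose[OF assms(2)])
qed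

lemma dist_of_fun_at_top:
  assumes "\<phi> \<in> test_functions" and "(F \<longlongrightarrow> L) at_top"
  shows "((\<lambda>s. dist_of_fun F (\<lambda>x. \<phi> (x - s))) \<longlongrightarrow> L * (LINT y|lborel. \<phi> y)) at_top"
proof -
  have "((\<lambda>s. LINT y|lborel. F (s + 1 * y) * \<phi> y) \<longlongrightarrow> L * (LINT y|lborel. \<phi> y)) at_top"
  proof (rule integral_affine_tendsto[OF assms(1)])
    fix y :: real
    have "filterlim (\<lambda>s. s + 1 * y) at_top at_top"
      unfolding filterlim_at_top_dense eventually_at_top_dense
    proof
      fix Z show "\<exists>N. \<forall>n>N. Z < n + 1 * y" by (intro exI[of _ "Z - y"]) auto
    qed
    then show "((\<lambda>s. F (s + 1 * y)) \<longlongrightarrow> L) at_top" by (rule filterlim_compose[OF assms(2)])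
  qed
  then show ?thesis
    using dist_of_fun_shift[OF assms(1), of "- s" for s] by simp
qed

text \<open>Substituting \<open>y = c x + d\<close> produces the Jacobian \<open>1 / c\<close>,
  which the factor \<open>c\<close> cancels.\<close>

lemma dist_of_fun_scale:
  assumes t: "\<phi> \<in> test_functions" and c: "c > 0"
  shows "c * dist_of_fun F (\<lambda>x. \<phi> (c * x + d)) = (LINT y|lborel. F ((- d / c) + (1 / c) * y) * \<phi> y)"
proof -
  have "dist_of_fun F (\<lambda>x. \<phi> (c * x + d)) = (LINT x|lborel. F x * \<phi> (c * x + d))"
    using t c by (simp add: dist_of_fun_def test_affine)
  also have "\<dots> = \<bar>1 / c\<bar> *\<^sub>R (LINT y|lborel. F (- d / c + (1 / c) * y) * \<phi> (c * (- d / c + (1 / c) * y) + d))"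
    using c by (intro lborel_integral_real_affine) auto
  also have "(\<lambda>y. c * (- d / c + (1 / c) * y) + d) = (\<lambda>y. y)"
    using c by (auto simp: field_simps)
  finally show ?thesis using c by simp
qed

text \<open>With the shift \<open>- c p\<close> the dilated test functions concentrate at
  \<open>p\<close>, and a support on the negative axis makes them approach it from the left
  only.\<close>

lemma dist_of_fun_left_limit:
  assumes t: "\<phi> \<in> test_functions" and neg: "\<And>y. \<phi> y \<noteq> 0 \<Longrightarrow> y < 0"
    and lim: "(F \<longlongrightarrow> L) (at_left p)"
  shows "((\<lambda>c. c * dist_of_fun F (\<lambda>x. \<phi> (c * x + - c * p))) \<longlongrightarrow> L * (LINT y|lborel. \<phi> y)) at_top"
proof -
  have "((\<lambda>c. LINT y|lborel. F (p + (1 / c) * y) * \<phi> y) \<longlongrightarrow> L * (LINT y|lborel. \<phi> y)) at_top"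
  proof (rule integral_affine_tendsto[OF t])
    fix y assume "\<phi> y \<noteq> 0"
    then have y: "y < 0" by (rule neg)
    have "((\<lambda>c::real. 1 / c) \<longlongrightarrow> 0) at_top"
      using tendsto_inverse_0_at_top[OF filterlim_ident] by (simp add: inverse_eq_divide)
    then have "((\<lambda>c. p + (1 / c) * y) \<longlongrightarrow> p + 0 * y) at_top"
      by (intro tendsto_intros)
    moreover have "\<forall>\<^sub>F c in at_top. p + (1 / c) * y < p"
      using eventually_gt_at_top[of 0] by eventually_elim (use y in \<open>simp add: divide_neg_pos\<close>)
    ultimately have "filterlim (\<lambda>c. p + (1 / c) * y) (at_left p) at_top"
      by (auto simp: filterlim_at elim: eventually_mono)
    then show "((\<lambda>c. F (p + (1 / c) * y)) \<longlongrightarrow> L) at_top" by (rule filterlim_compose[OF lim])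
  qed
  moreover have "\<forall>\<^sub>F c in at_top. (LINT y|lborel. F (p + (1 / c) * y) * \<phi> y) =
      c * dist_of_fun F (\<lambda>x. \<phi> (c * x + - c * p))"
    using eventually_gt_at_top[of 0]
    by eventually_elim (subst dist_of_fun_scale[OF t], auto)
  ultimately show ?thesis by (rule Lim_transform_eventually)
qed

text \<open>The bound does not depend on \<open>c\<close>; this is what \<open>dirac\<close> and its
  derivatives violate.\<close>

lemma dist_of_fun_scale_bound:
  assumes t: "\<phi> \<in> test_functions" and c: "c > 0"
  shows "\<bar>c * dist_of_fun F (\<lambda>x. \<phi> (c * x))\<bar> \<le> (LINT y|lborel. C * \<bar>\<phi> y\<bar>)"
proof -
  interpret scaled: bounded_measurable "\<lambda>y. F (1 / c * y)" C
    by unfold_locales (measurable, rule bound)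
  have "c * dist_of_fun F (\<lambda>x. \<phi> (c * x)) = (LINT y|lborel. F (1 / c * y) * \<phi> y)"
    using dist_of_fun_scale[OF t c, of 0] by simp
  also have "norm \<dots> \<le> (LINT y|lborel. C * \<bar>\<phi> y\<bar>)"
  proof (rule Bochner_Integration.integral_norm_bound_integral)
    fix y show "norm (F (1 / c * y) * \<phi> y) \<le> C * \<bar>\<phi> y\<bar>"
      by (simp only: real_norm_def abs_mult mult_right_mono bound abs_ge_zero)
  qed (use scaled.integrable_mult_test[OF t] test_integrable[OF t] in simp_all)
  finally show ?thesis by simp
qed

end

section \<open>Distribution functions of finite measures\<close>

text \<open>The strict inequality makes it left continuous, as \<open>B_r\<close> requires, whereas
  \<open>cdf\<close> is right continuous. The \<open>ereal\<close> argument includes the values at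
  both infinities.\<close>

definition left_cdf :: "real measure \<Rightarrow> ereal \<Rightarrow> real" where
  "left_cdf M x = measure M {y. ereal y < x}"

lemma left_cdf_simps [simp]:
  "left_cdf M (ereal x) = measure M {..<x}"
  "left_cdf M (-\<infinity>) = 0"
  "left_cdf M \<infinity> = measure M UNIV"
  by (simp_all add: left_cdf_def lessThan_def)

context finite_borel_measure
begin

lemma measure_lessThan_at_bot: "((\<lambda>x. measure M {..<x}) \<longlongrightarrow> 0) at_bot"
proof (rule tendsto_sandwich[OF _ _ tendsto_const cdf_lim_at_bot])
  show "\<forall>\<^sub>F x in at_bot. measure M {..<x} \<le> cdf M x"
    by (auto simp: cdf_def intro!: always_eventually finite_measure_mono)
qed auto

lemma measure_lessThan_at_top: "((\<lambda>x. measure M {..<x}) \<longlongrightarrow> measure M UNIV) at_top"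
proof (rule tendsto_sandwich[where f = "\<lambda>x. cdf M (x - 1)" and h = "\<lambda>_. measure M UNIV"])
  have "((\<lambda>x. cdf M (-1 + x)) \<longlongrightarrow> measure M (space M)) at_top"
    by (rule filterlim_compose[OF cdf_lim_at_top])
      (rule filterlim_tendsto_add_at_top[OF tendsto_const filterlim_ident])
  then show "((\<lambda>x. cdf M (x - 1)) \<longlongrightarrow> measure M UNIV) at_top" by (simp add: borel_UNIV)
qed (auto simp: cdf_def intro!: always_eventually finite_measure_mono)

text \<open>Continuity from below: along a sequence increasing to \<open>a\<close> the half-lines
  \<open>{..<f n}\<close> exhaust \<open>{..<a}\<close>.\<close>

lemma measure_lessThan_at_left: "((\<lambda>x. measure M {..<x}) \<longlongrightarrow> measure M {..<a}) (at_left a)"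
proof (rule tendsto_at_left_sequentially[of "a - 1"])
  fix f :: "nat \<Rightarrow> real" assume f: "incseq f" "f \<longlonglongrightarrow> a" "\<And>n. f n < a"
  have "(\<lambda>n. measure M {..<f n}) \<longlonglongrightarrow> measure M (\<Union>n. {..<f n})"
    using f(1) by (intro finite_Lim_measure_incseq) (auto simp: incseq_def intro: less_le_trans)
  also have "(\<Union>n. {..<f n}) = {..<a}"
    by (auto dest!: order_tendstoD(1)[OF f(2)] eventually_happens'[OF sequentially_bot]
        intro: less_trans f(3))
  finally show "(\<lambda>n. measure M {..<f n}) \<longlonglongrightarrow> measure M {..<a}" .
qed simp

text \<open>For \<open>x > a\<close> one has
  \<open>{..a} \<subseteq> {..<x} \<subseteq> {..x}\<close>, and \<open>cdf M\<close> is right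
  continuous.\<close>

lemma measure_lessThan_at_right: "((\<lambda>x. measure M {..<x}) \<longlongrightarrow> measure M {..a}) (at_right a)"
proof (rule tendsto_sandwich[where h = "cdf M" and f = "\<lambda>_. measure M {..a}"])
  show "(cdf M \<longlongrightarrow> measure M {..a}) (at_right a)"
    using cdf_is_right_cont[of a] by (simp add: continuous_within cdf_def)
  show "\<forall>\<^sub>F x in at_right a. measure M {..a} \<le> measure M {..<x}"
    using eventually_at_right_less[of a]
    by eventually_elim (auto intro!: finite_measure_mono)
qed (auto simp: cdf_def intro!: always_eventually finite_measure_mono)

lemma left_cdf_B_r: "left_cdf M \<in> B_r"
  unfolding B_r_def regulated_def
  using measure_lessThan_at_bot measure_lessThan_at_top measure_lessThan_at_left
    measure_lessThan_at_right
  by auto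

lemma bounded_measurable_left_cdf:
  "bounded_measurable (\<lambda>x. left_cdf M (ereal x)) (measure M UNIV)"
proof
  show "(\<lambda>x. left_cdf M (ereal x)) \<in> borel_measurable borel"
    by (intro borel_measurable_mono monoI) (auto intro!: finite_measure_mono)
qed (use bounded_measure borel_UNIV in simp)

lemma test_integrable_measure: "\<phi> \<in> test_functions \<Longrightarrow> integrable M \<phi>"
proof -
  assume t: "\<phi> \<in> test_functions"
  obtain R where R: "R > 0" "\<And>x. R \<le> \<bar>x\<bar> \<Longrightarrow> \<phi> x = 0" using test_support[OF t] by blast
  have "bounded (\<phi> ` {-R..R})"
    using t by (intro compact_imp_bounded compact_continuous_image test_continuous) auto
  then obtain B where B: "B > 0" "\<And>x. x \<in> {-R..R} \<Longrightarrow> \<bar>\<phi> x\<bar> \<le> B"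
    by (auto simp: bounded_pos)
  have "\<bar>\<phi> x\<bar> \<le> B" for x
    using B R(2)[of x] by (cases "x \<in> {-R..R}") auto
  then show "integrable M \<phi>"
    using test_measurable[OF t] by (intro integrable_const_bound[of _ B]) (auto simp: measurable_cong_sets[OF M_is_borel refl])
qed

text \<open>The measure is finite, so the integrals differ by at most the uniform distance times the
  total mass. This gives the continuity of \<open>dist_of_measure\<close>.\<close>

lemma integral_uniform_limit:
  assumes t: "\<And>j. \<phi> j \<in> test_functions" "\<psi> \<in> test_functions"
    and lim: "uniform_limit UNIV \<phi> \<psi> sequentially"
  shows "(\<lambda>j. LINT x|M. \<phi> j x) \<longlonglongrightarrow> (LINT x|M. \<psi> x)"
proof (rule tendstoI)
  fix e :: real assume e: "e > 0"
  \<comment> \<open>The summand 1 avoids division by 0 for the zero measure and makes the final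
    inequality strict.\<close>
  define d where "d = e / (measure M UNIV + 1)"
  have d: "d > 0" using e by (auto simp: d_def intro!: divide_pos_pos add_nonneg_pos)
  have "\<forall>\<^sub>F j in sequentially. \<forall>x\<in>UNIV. dist (\<phi> j x) (\<psi> x) < d"
    using lim d by (rule uniform_limitD)
  then show "\<forall>\<^sub>F j in sequentially. dist (LINT x|M. \<phi> j x) (LINT x|M. \<psi> x) < e"
  proof eventually_elim
    case (elim j)
    have int: "integrable M (\<phi> j)" "integrable M \<psi>" using t test_integrable_measure by auto
    have "dist (LINT x|M. \<phi> j x) (LINT x|M. \<psi> x) = \<bar>LINT x|M. \<phi> j x - \<psi> x\<bar>"
      using int by (simp add: dist_real_def)
    also have "\<dots> \<le> (LINT x|M. \<bar>\<phi> j x - \<psi> x\<bar>)" by (rule integral_abs_bound)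
    also have "\<dots> \<le> (LINT x|M. d)"
      using elim int by (intro integral_mono) (auto simp: dist_real_def less_imp_le)
    also have "\<dots> = e * (measure M UNIV / (measure M UNIV + 1))" by (simp add: d_def borel_UNIV)
    also have "\<dots> < e * 1"
    proof (intro mult_strict_left_mono e)
      have "measure M UNIV + 1 > 0" by (intro add_nonneg_pos) auto
      then show "measure M UNIV / (measure M UNIV + 1) < 1" by simp
    qed
    finally show ?case by simp
  qed
qed

text \<open>Fubini for \<open>deriv \<phi> x\<close> on the region \<open>y < x\<close>: integrating
  over \<open>y\<close> first gives \<open>left_cdf M x * deriv \<phi> x\<close>, integrating over
  \<open>x\<close> first gives \<open>- \<phi> y\<close>.\<close>

lemma dist_deriv_left_cdf:
  assumes t: "\<phi> \<in> test_functions"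
  shows "dist_deriv (dist_of_fun (\<lambda>x. left_cdf M (ereal x))) \<phi> = (LINT y|M. \<phi> y)"
proof -
  interpret pair_sigma_finite M lborel ..
  note M_is_borel [measurable_cong]
  have [measurable]: "deriv \<phi> \<in> borel_measurable borel"
    using test_measurable[OF test_deriv[OF t]] .
  \<comment> \<open>The majorant for Fubini: \<open>deriv \<phi>\<close> is integrable in
    \<open>x\<close>, constant in \<open>y\<close>, and \<open>M\<close> is finite.\<close>
  have "integrable (M \<Otimes>\<^sub>M lborel) (\<lambda>p. deriv \<phi> (snd p))"
    by (rule Fubini_integrable) (use test_integrable[OF test_deriv[OF t]] in simp_all)
  then have "integrable (M \<Otimes>\<^sub>M lborel) (\<lambda>(y, x). indicator {y<..} x * deriv \<phi> x)"
  proof (rule Bochner_Integration.integrable_bound)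
    have "(\<lambda>(y, x). indicator {y<..} x * deriv \<phi> x) = (\<lambda>(y, x). if y < x then deriv \<phi> x else 0)"
      by (auto simp: indicator_def)
    also have "\<dots> \<in> borel_measurable (M \<Otimes>\<^sub>M lborel)" by measurable
    finally show "(\<lambda>(y, x). indicator {y<..} x * deriv \<phi> x) \<in> borel_measurable (M \<Otimes>\<^sub>M lborel)" .
  qed (auto simp: indicator_def)
  then have fubini: "(LINT x|lborel. LINT y|M. indicator {y<..} x * deriv \<phi> x) =
      (LINT y|M. LINT x|lborel. indicator {y<..} x * deriv \<phi> x)"
    by (rule Fubini_integral)
  have inner: "(LINT y|M. indicator {y<..} x * deriv \<phi> x) = measure M {..<x} * deriv \<phi> x" for x
  proof -
    have "(\<lambda>y. indicator {y<..} x * deriv \<phi> x) = (\<lambda>y. indicator {..<x} y * deriv \<phi> x)"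
      by (auto simp: indicator_def)
    then show ?thesis by (simp add: borel_UNIV)
  qed
  have "(LINT x|lborel. indicator {y<..} x * deriv \<phi> x) = - \<phi> y" for y
    using test_eq_integral_deriv[OF t, of y] by simp
  then have "(LINT x|lborel. measure M {..<x} * deriv \<phi> x) = - (LINT y|M. \<phi> y)"
    using fubini by (simp only: inner) simp
  then show ?thesis
    using t by (simp add: dist_deriv_apply dist_of_fun_def test_deriv)
qed

end

section \<open>Regulated primitives\<close>

lemma B_r_diff:
  assumes "F \<in> B_r" "G \<in> B_r"
  shows "(\<lambda>x. F x - G x) \<in> B_r"
proof -
  have "\<exists>l. ((\<lambda>t. F (ereal t) - G (ereal t)) \<longlongrightarrow> l) A"
    if "\<exists>l. ((\<lambda>t. F (ereal t)) \<longlongrightarrow> l) A" "\<exists>l. ((\<lambda>t. G (ereal t)) \<longlongrightarrow> l) A" for A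
  proof -
    obtain l l' where "((\<lambda>t. F (ereal t)) \<longlongrightarrow> l) A" "((\<lambda>t. G (ereal t)) \<longlongrightarrow> l') A"
      using \<open>\<exists>l. ((\<lambda>t. F (ereal t)) \<longlongrightarrow> l) A\<close> \<open>\<exists>l. ((\<lambda>t. G (ereal t)) \<longlongrightarrow> l) A\<close> by blast
    then show ?thesis by (intro exI[of _ "l - l'"] tendsto_diff)
  qed
  moreover have "((\<lambda>t. F (ereal t) - G (ereal t)) \<longlongrightarrow> 0 - 0) at_bot"
    using assms unfolding B_r_def regulated_def by (intro tendsto_diff) auto
  ultimately show ?thesis
    using assms unfolding B_r_def regulated_def by (auto intro: tendsto_diff)
qed

lemma B_r_tendsto:
  assumes "F \<in> B_r"
  shows "((\<lambda>t. F (ereal t)) \<longlongrightarrow> 0) at_bot"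
    and "((\<lambda>t. F (ereal t)) \<longlongrightarrow> F \<infinity>) at_top"
    and "((\<lambda>t. F (ereal t)) \<longlongrightarrow> F (ereal x)) (at_left x)"
  using assms unfolding B_r_def regulated_def by auto

lemma B_c_tendsto:
  assumes "F \<in> B_c"
  shows "((\<lambda>t. F (ereal t)) \<longlongrightarrow> F (-\<infinity>)) at_bot"
    and "((\<lambda>t. F (ereal t)) \<longlongrightarrow> F \<infinity>) at_top"
    and "((\<lambda>t. F (ereal t)) \<longlongrightarrow> F (ereal x)) (at x)"
proof -
  \<comment> \<open>With \<open>nhds y\<close> in place of \<open>at y\<close>, composing limits
    needs no check that the inner function avoids \<open>y\<close>.\<close>
  have lim: "(F \<longlongrightarrow> F y) (nhds y)" for y
    using assms by (simp add: B_c_def continuous_on_eq_continuous_at isCont_def tendsto_at_iff_tendsto_nhds)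
  show "((\<lambda>t. F (ereal t)) \<longlongrightarrow> F (ereal x)) (at x)"
    by (rule filterlim_compose[OF lim], intro tendsto_intros)
  show "((\<lambda>t. F (ereal t)) \<longlongrightarrow> F (-\<infinity>)) at_bot"
    by (rule filterlim_compose[OF lim]) (auto simp: tendsto_MInfty eventually_at_bot_dense)
  show "((\<lambda>t. F (ereal t)) \<longlongrightarrow> F \<infinity>) at_top"
    by (rule filterlim_compose[OF lim]) (auto simp: tendsto_PInfty eventually_at_top_dense)
qed

lemma B_c_subset_B_r: "B_c \<subseteq> B_r"
proof
  fix F assume F: "F \<in> B_c"
  have "((\<lambda>t. F (ereal t)) \<longlongrightarrow> F (ereal x)) (at_left x)"
       "((\<lambda>t. F (ereal t)) \<longlongrightarrow> F (ereal x)) (at_right x)" for x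
    using B_c_tendsto(3)[OF F, of x] by (simp_all add: filterlim_at_split)
  with B_c_tendsto(1,2)[OF F] show "F \<in> B_r"
    using F unfolding B_r_def regulated_def B_c_def by blast
qed

section \<open>Measurability and boundedness of primitives\<close>

lemma left_continuous_borel_measurable:
  fixes F :: "real \<Rightarrow> real"
  assumes lim: "\<And>x. (F \<longlongrightarrow> F x) (at_left x)"
  shows "F \<in> borel_measurable borel"
proof (rule borel_measurable_LIMSEQ_real)
  fix x :: real
  \<comment> \<open>The largest multiple of \<open>1 / Suc n\<close> strictly below
    \<open>x\<close>. Ceiling minus 1, unlike the floor, stays strictly below \<open>x\<close> on
    grid points too, so that left continuity applies and \<open>F\<close> is a pointwise limit of
    step functions.\<close>
  let ?g = "\<lambda>n. (of_int \<lceil>x * Suc n\<rceil> - 1) / Suc n"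
  have less: "?g n < x" and ge: "x - 1 / Suc n \<le> ?g n" for n
    by (simp_all add: field_simps del: of_nat_Suc) linarith+
  have "(\<lambda>n. ?g n) \<longlonglongrightarrow> x"
  proof (rule tendsto_sandwich[OF _ _ _ tendsto_const])
    show "(\<lambda>n. x - 1 / Suc n) \<longlonglongrightarrow> x"
      using tendsto_diff[OF tendsto_const LIMSEQ_inverse_real_of_nat, of x] by (simp add: inverse_eq_divide)
  qed (use less ge in \<open>auto intro!: always_eventually less_imp_le\<close>)
  then have "filterlim (\<lambda>n. ?g n) (at_left x) sequentially"
    using less less[THEN less_imp_neq] by (simp add: filterlim_at del: of_nat_Suc)
  then show "(\<lambda>n. F (?g n)) \<longlonglongrightarrow> F x" by (rule filterlim_compose[OF lim])
next
  fix n
  have "(\<lambda>k::int. F ((of_int k - 1) / Suc n)) \<in> measurable (count_space UNIV) borel" by simp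
  moreover have "(\<lambda>x::real. \<lceil>x * Suc n\<rceil>) \<in> measurable borel (count_space UNIV)" by measurable
  ultimately show "(\<lambda>x::real. F ((of_int \<lceil>x * Suc n\<rceil> - 1) / Suc n)) \<in> borel_measurable borel"
    by (rule measurable_compose[rotated])
qed

text \<open>The limits bound \<open>F\<close> near both infinities and, by one-sided limits, near
  each point. Bisection glues the local bounds on the remaining compact interval.\<close>

lemma regulated_bounded:
  fixes F :: "real \<Rightarrow> real"
  assumes left: "\<And>x. \<exists>l. (F \<longlongrightarrow> l) (at_left x)" and right: "\<And>x. \<exists>l. (F \<longlongrightarrow> l) (at_right x)"
    and bot: "(F \<longlongrightarrow> L) at_bot" and top: "(F \<longlongrightarrow> L') at_top"
  obtains C where "\<And>x. \<bar>F x\<bar> \<le> C"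
proof -
  have ev: "\<exists>B. \<forall>\<^sub>F t in A. \<bar>F t\<bar> \<le> B" if "(F \<longlongrightarrow> l) A" for A l
  proof -
    have "\<forall>\<^sub>F t in A. dist (F t) l < 1" using that by (rule tendstoD) simp
    then have "\<forall>\<^sub>F t in A. \<bar>F t\<bar> \<le> \<bar>l\<bar> + 1" by eventually_elim (auto simp: dist_real_def)
    then show ?thesis by blast
  qed
  obtain B1 N1 where B1: "\<And>t. t \<le> N1 \<Longrightarrow> \<bar>F t\<bar> \<le> B1"
    using ev[OF bot] by (auto simp: eventually_at_bot_linorder)
  obtain B2 N2 where B2: "\<And>t. t \<ge> N2 \<Longrightarrow> \<bar>F t\<bar> \<le> B2"
    using ev[OF top] by (auto simp: eventually_at_top_linorder)
  have "\<exists>B. \<forall>t\<in>{N1..max N1 N2}. \<bar>F t\<bar> \<le> B"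
  proof (rule Bolzano[of N1 "max N1 N2" "\<lambda>a b. \<exists>B. \<forall>t\<in>{a..b}. \<bar>F t\<bar> \<le> B"])
    fix a b c
    assume "\<exists>B. \<forall>t\<in>{a..b}. \<bar>F t\<bar> \<le> B" "\<exists>B. \<forall>t\<in>{b..c}. \<bar>F t\<bar> \<le> B"
    then obtain B B' where "\<forall>t\<in>{a..b}. \<bar>F t\<bar> \<le> B" "\<forall>t\<in>{b..c}. \<bar>F t\<bar> \<le> B'" by blast
    then have "\<forall>t\<in>{a..c}. \<bar>F t\<bar> \<le> max B B'"
      by (metis atLeastAtMost_iff le_max_iff_disj linear)
    then show "\<exists>B. \<forall>t\<in>{a..c}. \<bar>F t\<bar> \<le> B" by blast
  next
    fix x
    obtain l r where "(F \<longlongrightarrow> l) (at_left x)" "(F \<longlongrightarrow> r) (at_right x)" using left right by blast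
    then obtain B B' where "\<forall>\<^sub>F t in at_left x. \<bar>F t\<bar> \<le> B" "\<forall>\<^sub>F t in at_right x. \<bar>F t\<bar> \<le> B'"
      using ev by meson
    then have "\<forall>\<^sub>F t in at_left x. \<bar>F t\<bar> \<le> max B B'" "\<forall>\<^sub>F t in at_right x. \<bar>F t\<bar> \<le> max B B'"
      by (auto elim: eventually_mono)
    then have "\<forall>\<^sub>F t in at x. \<bar>F t\<bar> \<le> max B B'"
      by (simp only: eventually_at_split)
    then obtain d where d: "d > 0" "\<And>t. t \<noteq> x \<Longrightarrow> dist t x < d \<Longrightarrow> \<bar>F t\<bar> \<le> max B B'"
      by (auto simp: eventually_at)
    \<comment> \<open>One-sided limits say nothing about the value at \<open>x\<close>, so it enters
      the bound separately.\<close>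
    have "\<bar>F t\<bar> \<le> max (max B B') \<bar>F x\<bar>" if "a \<le> x" "x \<le> b" "b - a < d" "t \<in> {a..b}" for a b t
    proof (cases "t = x")
      case False
      have "\<bar>t - x\<bar> < d" using that by (simp only: atLeastAtMost_iff) linarith
      with d(2)[OF False] show ?thesis by (simp add: dist_real_def le_max_iff_disj)
    qed simp
    then show "\<exists>d>0. \<forall>a b. a \<le> x \<and> x \<le> b \<and> b - a < d \<longrightarrow> (\<exists>B. \<forall>t\<in>{a..b}. \<bar>F t\<bar> \<le> B)"
      using d(1) by blast
  qed simp
  then obtain B3 where B3: "\<And>t. t \<in> {N1..max N1 N2} \<Longrightarrow> \<bar>F t\<bar> \<le> B3" by blast
  have "\<bar>F x\<bar> \<le> max B1 (max B2 B3)" for x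
    using B1[of x] B2[of x] B3[of x] by (cases "x \<le> N1"; cases "x \<ge> N2") (auto simp: le_max_iff_disj)
  then show thesis by (rule that)
qed

lemma B_r_bounded_measurable:
  assumes "F \<in> B_r"
  obtains C where "bounded_measurable (\<lambda>x. F (ereal x)) C"
proof -
  obtain C where "\<And>x. \<bar>F (ereal x)\<bar> \<le> C"
    using assms by (rule_tac regulated_bounded[of "\<lambda>x. F (ereal x)"]) (auto simp: B_r_def regulated_def)
  moreover have "(\<lambda>x. F (ereal x)) \<in> borel_measurable borel"
    using B_r_tendsto(3)[OF assms] by (rule left_continuous_borel_measurable)
  ultimately show thesis by (intro that bounded_measurable.intro)
qed

section \<open>The Jordan decomposition\<close>

lemma finite_signed_borel_measure_uminus:
  "finite_signed_borel_measure \<mu> \<Longrightarrow> finite_signed_borel_measure (\<lambda>A. - \<mu> A)"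
  unfolding finite_signed_borel_measure_def by (auto intro: sums_minus)

text \<open>The set function passed to \<open>measure_of\<close> in \<open>pos_part_measure\<close>,
  named so that its additivity can be proved before it becomes a measure.\<close>

definition upper_variation :: "(real set \<Rightarrow> real) \<Rightarrow> real set \<Rightarrow> ennreal" where
  "upper_variation \<mu> A = (SUP B\<in>{B \<in> sets borel. B \<subseteq> A}. ennreal (\<mu> B))"

context
  fixes \<mu> :: "real set \<Rightarrow> real"
  assumes \<mu>: "finite_signed_borel_measure \<mu>"
begin

lemma signed_empty: "\<mu> {} = 0"
  using \<mu> by (simp add: finite_signed_borel_measure_def)

lemma signed_sums:
  fixes A :: "nat \<Rightarrow> real set"
  assumes "\<And>i. A i \<in> sets borel" "disjoint_family A"
  shows "(\<lambda>i. \<mu> (A i)) sums \<mu> (\<Union>i. A i)"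
  using \<mu> assms unfolding finite_signed_borel_measure_def by blast

lemma signed_Un:
  assumes "A \<in> sets borel" "B \<in> sets borel" "A \<inter> B = {}"
  shows "\<mu> (A \<union> B) = \<mu> A + \<mu> B"
proof -
  have "disjoint_family (binaryset A B)"
    using assms(3) by (auto simp: disjoint_family_on_def binaryset_def)
  then have "(\<lambda>i. \<mu> (binaryset A B i)) sums \<mu> (A \<union> B)"
    using signed_sums[of "binaryset A B"] assms by (auto simp: UN_binaryset_eq binaryset_def)
  moreover have "(\<lambda>i. \<mu> (binaryset A B i)) sums (\<mu> A + \<mu> B)"
    using signed_empty by (rule binaryset_sums)
  ultimately show ?thesis by (rule sums_unique2)
qed

lemma signed_Diff:
  assumes "A \<in> sets borel" "B \<in> sets borel" "B \<subseteq> A"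
  shows "\<mu> (A - B) = \<mu> A - \<mu> B"
  using signed_Un[of B "A - B"] assms by (auto simp: Un_absorb1)

lemma ennreal_signed_le:
  "B \<in> sets borel \<Longrightarrow> B \<subseteq> A \<Longrightarrow> ennreal (\<mu> B) \<le> upper_variation \<mu> A"
  unfolding upper_variation_def by (rule SUP_upper) simp

lemma upper_variation_mono: "A \<subseteq> B \<Longrightarrow> upper_variation \<mu> A \<le> upper_variation \<mu> B"
  unfolding upper_variation_def by (rule SUP_subset_mono) auto

text \<open>Borel sets \<open>B \<subseteq> X\<close> and \<open>C \<subseteq> Y\<close> are
  disjoint, so \<open>B \<union> C\<close> competes in the supremum for
  \<open>X \<union> Y\<close>.\<close>

lemma upper_variation_superadditive:
  assumes "X \<inter> Y = {}"
  shows "upper_variation \<mu> X + upper_variation \<mu> Y \<le> upper_variation \<mu> (X \<union> Y)"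
proof -
  have ne: "{B \<in> sets borel. B \<subseteq> Z} \<noteq> {}" for Z :: "real set" by blast
  have "upper_variation \<mu> X + upper_variation \<mu> Y =
      (SUP B\<in>{B \<in> sets borel. B \<subseteq> X}. ennreal (\<mu> B) + upper_variation \<mu> Y)"
    unfolding upper_variation_def[of \<mu> X] by (rule ennreal_SUP_add_left[OF ne, symmetric])
  also have "\<dots> \<le> upper_variation \<mu> (X \<union> Y)"
  proof (rule SUP_least)
    fix B assume "B \<in> {B \<in> sets borel. B \<subseteq> X}"
    then have B: "B \<in> sets borel" "B \<subseteq> X" by auto
    have "ennreal (\<mu> B) + upper_variation \<mu> Y =
        (SUP C\<in>{C \<in> sets borel. C \<subseteq> Y}. ennreal (\<mu> B) + ennreal (\<mu> C))"
      unfolding upper_variation_def by (rule ennreal_SUP_add_right[OF ne])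
    also have "\<dots> \<le> upper_variation \<mu> (X \<union> Y)"
    proof (rule SUP_least)
      fix C assume "C \<in> {C \<in> sets borel. C \<subseteq> Y}"
      then have C: "C \<in> sets borel" "C \<subseteq> Y" by auto
      have le: "ennreal (\<mu> E) \<le> upper_variation \<mu> (X \<union> Y)" if "E \<in> {B, C, B \<union> C}" for E
        using that B C by (intro ennreal_signed_le) auto
      \<comment> \<open>A set of negative mass would spoil the union but counts as 0 under
        \<open>ennreal\<close>, so in that case the other set alone is the competitor.\<close>
      consider "\<mu> B \<le> 0" | "\<mu> C \<le> 0" | "\<mu> B \<ge> 0" "\<mu> C \<ge> 0" by linarith
      then show "ennreal (\<mu> B) + ennreal (\<mu> C) \<le> upper_variation \<mu> (X \<union> Y)"
      proof cases
        case 1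
        then show ?thesis using le[of C] by (simp add: ennreal_neg)
      next
        case 2
        then show ?thesis using le[of B] by (simp add: ennreal_neg)
      next
        case 3
        have "\<mu> (B \<union> C) = \<mu> B + \<mu> C" using B C assms by (intro signed_Un) auto
        then have "ennreal (\<mu> B) + ennreal (\<mu> C) = ennreal (\<mu> (B \<union> C))" using 3 by simp
        then show ?thesis using le[of "B \<union> C"] by simp
      qed
    qed
    finally show "ennreal (\<mu> B) + upper_variation \<mu> Y \<le> upper_variation \<mu> (X \<union> Y)" .
  qed
  finally show ?thesis .
qed

text \<open>One inequality is superadditivity on finite unions. For the other, a competitor
  \<open>B\<close> for the union is cut into the pieces \<open>B \<inter> A i\<close>, each a
  competitor for \<open>A i\<close>.\<close>

lemma upper_variation_countably_additive:
  "countably_additive (sets borel) (upper_variation \<mu>)"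
proof (rule countably_additiveI)
  fix A :: "nat \<Rightarrow> real set"
  assume A: "range A \<subseteq> sets borel" "disjoint_family A"
  show "(\<Sum>i. upper_variation \<mu> (A i)) = upper_variation \<mu> (\<Union>i. A i)"
  proof (rule antisym)
    have "(\<Sum>i<n. upper_variation \<mu> (A i)) \<le> upper_variation \<mu> (\<Union>i. A i)" for n
    proof -
      have "(\<Sum>i<n. upper_variation \<mu> (A i)) \<le> upper_variation \<mu> (\<Union>i<n. A i)"
      proof (induction n)
        case (Suc n)
        have "A n \<inter> (\<Union>i<n. A i) = {}"
          using disjoint_family_onD[OF A(2), of n] by fastforce
        then show ?case
          using order_trans[OF add_left_mono[OF Suc] upper_variation_superadditive]
          by (simp add: lessThan_Suc add.commute)
      qed simp
      also have "\<dots> \<le> upper_variation \<mu> (\<Union>i. A i)"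
        by (rule upper_variation_mono) auto
      finally show ?thesis .
    qed
    then show "(\<Sum>i. upper_variation \<mu> (A i)) \<le> upper_variation \<mu> (\<Union>i. A i)"
      by (intro suminf_le_const) auto
    show "upper_variation \<mu> (\<Union>i. A i) \<le> (\<Sum>i. upper_variation \<mu> (A i))" (is "_ \<le> ?S")
      unfolding upper_variation_def[of \<mu> "\<Union>i. A i"]
    proof (rule SUP_least)
      fix B assume "B \<in> {B \<in> sets borel. B \<subseteq> (\<Union>i. A i)}"
      then have B: "B \<in> sets borel" "(\<Union>i. B \<inter> A i) = B" by auto
      have "disjoint_family (\<lambda>i. B \<inter> A i)"
        using A(2) unfolding disjoint_family_on_def by blast
      then have "(\<lambda>i. \<mu> (B \<inter> A i)) sums \<mu> (\<Union>i. B \<inter> A i)"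
        using A B(1) by (intro signed_sums) auto
      then have "(\<lambda>n. \<Sum>i<n. \<mu> (B \<inter> A i)) \<longlonglongrightarrow> \<mu> B"
        by (simp only: B(2) sums_def)
      then have "(\<lambda>n. ennreal (\<Sum>i<n. \<mu> (B \<inter> A i))) \<longlonglongrightarrow> ennreal (\<mu> B)"
        by (rule tendsto_ennrealI)
      moreover have "ennreal (\<Sum>i<n. \<mu> (B \<inter> A i)) \<le> ?S" for n
      proof -
        have "ennreal (\<Sum>i<n. \<mu> (B \<inter> A i)) \<le> (\<Sum>i<n. ennreal (\<mu> (B \<inter> A i)))"
        proof (induction n)
          case (Suc n)
          \<comment> \<open>Truncation at 0 makes \<open>ennreal\<close> subadditive, but not
            additive, on reals of either sign.\<close>
          have "ennreal (a + b) \<le> ennreal a + ennreal b" for a b :: real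
            by (cases "a \<ge> 0"; cases "b \<ge> 0") (auto simp: ennreal_neg ennreal_leI)
          from order_trans[OF this add_right_mono[OF Suc]] show ?case
            by (simp only: sum.lessThan_Suc)
        qed simp
        also have "\<dots> \<le> (\<Sum>i<n. upper_variation \<mu> (A i))"
          using A B(1) by (intro sum_mono ennreal_signed_le) auto
        also have "\<dots> \<le> ?S"
          by (rule sum_le_suminf) auto
        finally show ?thesis .
      qed
      ultimately show "ennreal (\<mu> B) \<le> ?S"
        by (intro LIMSEQ_le_const2) auto
    qed
  qed
qed

section \<open>The positive part as a finite measure\<close>

lemma emeasure_pos_part:
  assumes "A \<in> sets borel"
  shows "emeasure (pos_part_measure \<mu>) A = upper_variation \<mu> A"
  unfolding pos_part_measure_def upper_variation_def[symmetric]
proof (rule emeasure_measure_of_sigma)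
  show "sigma_algebra UNIV (sets (borel :: real measure))"
    using sets.sigma_algebra_axioms[of borel] by simp
  have "{B \<in> sets borel. B \<subseteq> {}} = {{} :: real set}" by auto
  then show "positive (sets borel) (upper_variation \<mu>)"
    by (simp add: positive_def upper_variation_def signed_empty)
qed (rule upper_variation_countably_additive assms)+

lemma sets_pos_part [simp, measurable_cong]: "sets (pos_part_measure \<mu>) = sets borel"
  unfolding pos_part_measure_def
  using sets.sigma_sets_eq[of "borel :: real measure"] by (subst sets_measure_of) auto

lemma space_pos_part [simp]: "space (pos_part_measure \<mu>) = UNIV"
  unfolding pos_part_measure_def by (rule space_measure_of_conv)

text \<open>
  Otherwise a set of infinite upper variation always splits off a piece with \<open>\<bar>\<mu>\<bar> \<ge> 1\<close> such that the
  rest still has infinite upper variation; the resulting sequence of disjoint pieces contradicts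
  countable additivity.
\<close>

lemma finite_pos_part: "emeasure (pos_part_measure \<mu>) UNIV < \<infinity>"
proof (rule ccontr)
  let ?\<nu> = "emeasure (pos_part_measure \<mu>)"
  assume "\<not> ?\<nu> UNIV < \<infinity>"
  then have inf: "?\<nu> UNIV = \<infinity>" by (metis infinity_ennreal_def less_top)
  have split: "\<exists>A'. (A' \<in> sets borel \<and> ?\<nu> A' = \<infinity>) \<and> A' \<subseteq> A \<and> \<bar>\<mu> (A - A')\<bar> \<ge> 1"
    if A: "A \<in> sets borel \<and> ?\<nu> A = \<infinity>" for A
  proof -
    \<comment> \<open>The margin \<open>1 + |\<mu> A|\<close> forces both \<open>|\<mu> B|\<close>
      and \<open>|\<mu> (A - B)|\<close> to be at least 1, so whichever part has infinite variation
      may be kept and the other split off.\<close>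
    have "ennreal (1 + \<bar>\<mu> A\<bar>) < (SUP B\<in>{B \<in> sets borel. B \<subseteq> A}. ennreal (\<mu> B))"
      using A by (simp only: emeasure_pos_part[symmetric] upper_variation_def[symmetric])
        (metis ennreal_less_top infinity_ennreal_def)
    then obtain B where B: "B \<in> sets borel" "B \<subseteq> A" "ennreal (1 + \<bar>\<mu> A\<bar>) < ennreal (\<mu> B)"
      by (auto simp: less_SUP_iff)
    then have "1 + \<bar>\<mu> A\<bar> < \<mu> B" by (metis ennreal_leI not_le)
    moreover have "\<mu> (A - B) = \<mu> A - \<mu> B" using A B by (intro signed_Diff) auto
    ultimately have big: "\<bar>\<mu> B\<bar> \<ge> 1" "\<bar>\<mu> (A - B)\<bar> \<ge> 1" by linarith+
    have "?\<nu> B + ?\<nu> (A - B) = ?\<nu> (B \<union> (A - B))"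
      using A B by (intro plus_emeasure) auto
    also have "B \<union> (A - B) = A" using B by auto
    finally have "?\<nu> B = \<infinity> \<or> ?\<nu> (A - B) = \<infinity>" using A by (simp add: ennreal_add_eq_top)
    then show ?thesis
    proof
      assume "?\<nu> B = \<infinity>"
      then show ?thesis using B big by blast
    next
      assume *: "?\<nu> (A - B) = \<infinity>"
      have "A - (A - B) = B" using B by auto
      then show ?thesis using B big A * by (intro exI[of _ "A - B"]) auto
    qed
  qed
  have "\<exists>C. \<forall>n::nat. (C n \<in> sets borel \<and> ?\<nu> (C n) = \<infinity>) \<and>
      (C (Suc n) \<subseteq> C n \<and> \<bar>\<mu> (C n - C (Suc n))\<bar> \<ge> 1)"
  proof (rule dependent_nat_choice)
    show "\<exists>A. A \<in> sets borel \<and> ?\<nu> A = \<infinity>" using inf by (intro exI[of _ UNIV]) auto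
  qed (rule split)
  then obtain C where C: "\<And>n::nat. C n \<in> sets borel \<and> ?\<nu> (C n) = \<infinity>"
      "\<And>n. C (Suc n) \<subseteq> C n \<and> \<bar>\<mu> (C n - C (Suc n))\<bar> \<ge> 1"
    by metis
  have anti: "C n \<subseteq> C m" if "m \<le> n" for m n
    using that by (induction rule: dec_induct) (use C in auto)
  have "disjoint_family (\<lambda>n. C n - C (Suc n))"
    unfolding disjoint_family_on_def
  proof (intro ballI impI)
    fix m n :: nat assume "m \<noteq> n"
    then have "Suc m \<le> n \<or> Suc n \<le> m" by linarith
    then show "(C m - C (Suc m)) \<inter> (C n - C (Suc n)) = {}" using anti by blast
  qed
  then have "(\<lambda>n. \<mu> (C n - C (Suc n))) sums \<mu> (\<Union>n. C n - C (Suc n))"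
    using C by (intro signed_sums) auto
  then have "(\<lambda>n. \<mu> (C n - C (Suc n))) \<longlonglongrightarrow> 0"
    using sums_summable summable_LIMSEQ_zero by blast
  then have "\<forall>\<^sub>F n in sequentially. \<bar>\<mu> (C n - C (Suc n))\<bar> < 1"
    by (auto dest: tendstoD[of _ _ _ 1])
  then obtain n where "\<bar>\<mu> (C n - C (Suc n))\<bar> < 1"
    by (auto simp: eventually_sequentially)
  with C(2)[of n] show False by linarith
qed

lemma finite_borel_measure_pos_part: "finite_borel_measure (pos_part_measure \<mu>)"
proof (intro finite_borel_measure.intro finite_measureI finite_borel_measure_axioms.intro)
  show "emeasure (pos_part_measure \<mu>) (space (pos_part_measure \<mu>)) \<noteq> \<infinity>"
    using finite_pos_part by (simp only: space_pos_part infinity_ennreal_def less_top)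
qed (rule sets_pos_part)

end

lemma finite_borel_measure_neg_part:
  "finite_signed_borel_measure \<mu> \<Longrightarrow> finite_borel_measure (neg_part_measure \<mu>)"
  unfolding neg_part_measure_def
  by (intro finite_borel_measure_pos_part finite_signed_borel_measure_uminus)

section \<open>Uniqueness of primitives\<close>

text \<open>The integral is positive because a nonnegative function with integral 0 vanishes almost
  everywhere, while this one is positive on an interval of length 2.\<close>

lemma bump_at:
  obtains \<beta> :: "real \<Rightarrow> real" where "\<beta> \<in> test_functions" "\<And>x. \<beta> x \<noteq> 0 \<longleftrightarrow> \<bar>x - a\<bar> < 1"
    "(LINT x|lborel. \<beta> x) > 0"
proof -
  obtain b :: "real \<Rightarrow> real" where b: "b \<in> test_functions" "\<And>x. b x \<ge> 0" "\<And>x. b x > 0 \<longleftrightarrow> \<bar>x\<bar> < 1"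
    using bump_function_exists by blast
  define \<beta> where "\<beta> x = b (x + (- a))" for x
  have t: "\<beta> \<in> test_functions" unfolding \<beta>_def by (rule test_shift[OF b(1)])
  have pos: "\<beta> x \<ge> 0" "\<beta> x \<noteq> 0 \<longleftrightarrow> \<bar>x - a\<bar> < 1" for x
    using b(2,3)[of "x + (- a)"] by (auto simp: \<beta>_def order_le_less)
  have "(LINT x|lborel. \<beta> x) \<noteq> 0"
  proof
    assume "(LINT x|lborel. \<beta> x) = 0"
    then have "AE x in lborel. \<beta> x = 0"
      using integral_nonneg_eq_0_iff_AE[OF test_integrable[OF t]] pos(1) by simp
    then have "AE x in lborel. x \<notin> {a - 1<..<a + 1}"
    proof eventually_elim
      case (elim x)
      then show ?case using pos(2)[of x] by (auto simp: abs_if split: if_splits)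
    qed
    then have "{a - 1<..<a + 1} \<in> null_sets lborel"
      using AE_iff_null_sets[of "{a - 1<..<a + 1}" lborel] by simp
    then show False by (simp add: null_sets_def)
  qed
  moreover have "(LINT x|lborel. \<beta> x) \<ge> 0" using pos(1) by simp
  ultimately show thesis using that[OF t pos(2)] by linarith
qed

lemma B_r_linear: "F \<in> B_r \<Longrightarrow> linear_functional (dist_of_fun (\<lambda>x. F (ereal x)))"
  by (metis B_r_bounded_measurable bounded_measurable.linear_functional_fun)

lemma B_r_vanishes:
  assumes F: "F \<in> B_r"
  shows "vanishes_at_bot (dist_of_fun (\<lambda>x. F (ereal x)))"
  unfolding vanishes_at_bot_def
proof
  fix \<phi> assume t: "\<phi> \<in> test_functions"
  obtain C where "bounded_measurable (\<lambda>x. F (ereal x)) C" using B_r_bounded_measurable[OF F] .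
  from bounded_measurable.dist_of_fun_at_bot[OF this t B_r_tendsto(1)[OF F]]
  show "((\<lambda>s. dist_of_fun (\<lambda>x. F (ereal x)) (\<lambda>x. \<phi> (x + s))) \<longlongrightarrow> 0) at_top" by simp
qed

text \<open>Functions in \<open>B_r\<close> tend to 0 at minus infinity, so they and their
  derivatives satisfy \<open>vanishes_at_bot\<close>, and \<open>n\<close> common derivatives can be
  stripped. The excess \<open>j\<close> is 0 for uniqueness and positive for comparing different
  orders.\<close>

lemma nth_dist_deriv_cancel:
  assumes "F \<in> B_r" "G \<in> B_r" "nth_dist_deriv (n + j) F = nth_dist_deriv n G"
  shows "\<forall>\<phi>\<in>test_functions. nth_dist_deriv j F \<phi> = dist_of_fun (\<lambda>x. G (ereal x)) \<phi>"
proof -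
  note F = B_r_linear[OF assms(1)] B_r_vanishes[OF assms(1)]
  show ?thesis
    using assms(3) unfolding nth_dist_deriv_def funpow_add comp_apply
    by (rule dist_deriv_pow_eq_imp_eq[OF dist_deriv_pow_preserves(1)[OF F] B_r_linear[OF assms(2)]
          dist_deriv_pow_preserves(2)[OF F] B_r_vanishes[OF assms(2)]])
qed

text \<open>By left continuity each real value is a left limit, which the distribution recovers from
  test functions concentrating to the left of the point. The value at plus infinity follows as a
  limit, and the one at minus infinity is 0.\<close>

lemma dist_of_fun_determines:
  assumes F: "F \<in> B_r" and G: "G \<in> B_r"
    and eq: "\<forall>\<phi>\<in>test_functions. dist_of_fun (\<lambda>x. F (ereal x)) \<phi> = dist_of_fun (\<lambda>x. G (ereal x)) \<phi>"
  shows "F = G"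
proof
  \<comment> \<open>Centre -2 and radius 1 put the bump on the negative axis.\<close>
  obtain \<beta> :: "real \<Rightarrow> real" where \<beta>: "\<beta> \<in> test_functions" "\<And>y. \<beta> y \<noteq> 0 \<longleftrightarrow> \<bar>y - (-2)\<bar> < 1"
      "(LINT y|lborel. \<beta> y) > 0"
    using bump_at[of "-2"] by blast
  have neg: "y < 0" if "\<beta> y \<noteq> 0" for y using \<beta>(2)[of y] that by linarith
  have real: "F (ereal p) = G (ereal p)" for p
  proof -
    obtain C where "bounded_measurable (\<lambda>x. F (ereal x)) C" using B_r_bounded_measurable[OF F] .
    note F' = bounded_measurable.dist_of_fun_left_limit[OF this \<beta>(1) neg B_r_tendsto(3)[OF F, of p]]
    obtain C' where "bounded_measurable (\<lambda>x. G (ereal x)) C'" using B_r_bounded_measurable[OF G] .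
    note G' = bounded_measurable.dist_of_fun_left_limit[OF this \<beta>(1) neg B_r_tendsto(3)[OF G, of p]]
    have "\<forall>\<^sub>F c in at_top. c * dist_of_fun (\<lambda>x. F (ereal x)) (\<lambda>x. \<beta> (c * x + - c * p)) =
        c * dist_of_fun (\<lambda>x. G (ereal x)) (\<lambda>x. \<beta> (c * x + - c * p))"
      using eventually_gt_at_top[of 0]
    proof eventually_elim
      case (elim c)
      then have "(\<lambda>x. \<beta> (c * x + - c * p)) \<in> test_functions" by (intro test_affine \<beta>(1)) simp
      with eq show ?case by simp
    qed
    from Lim_transform_eventually[OF F' this]
    have "F (ereal p) * (LINT y|lborel. \<beta> y) = G (ereal p) * (LINT y|lborel. \<beta> y)"
      using G' by (intro tendsto_unique[OF trivial_limit_at_top_linorder])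
    then show ?thesis using \<beta>(3) by simp
  qed
  have "((\<lambda>t. F (ereal t)) \<longlongrightarrow> G \<infinity>) at_top" using B_r_tendsto(2)[OF G] by (simp add: real)
  then have "F \<infinity> = G \<infinity>"
    using B_r_tendsto(2)[OF F] by (intro tendsto_unique[OF trivial_limit_at_top_linorder])
  moreover have "F (-\<infinity>) = G (-\<infinity>)" using F G by (simp add: B_r_def)
  ultimately show "F x = G x" for x using real by (cases x) auto
qed

lemma nth_dist_deriv_inj:
  assumes "F \<in> B_r" "G \<in> B_r" "nth_dist_deriv n F = nth_dist_deriv n G"
  shows "F = G"
  using nth_dist_deriv_cancel[of F G n 0] assms
  by (intro dist_of_fun_determines) (auto simp: nth_dist_deriv_def)

text \<open>Test with translates of a bump moving to plus infinity. The side of \<open>G\<close>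
  tends to \<open>G \<infinity>\<close> times the integral of the bump; the side of \<open>F\<close>
  tends to a multiple of the integral of a derivative of the bump, which is 0.\<close>

lemma limit_eq_0_if_derivative:
  assumes F: "F \<in> B_r" and G: "G \<in> B_r"
    and eq: "\<forall>\<phi>\<in>test_functions. nth_dist_deriv (Suc j) F \<phi> = dist_of_fun (\<lambda>x. G (ereal x)) \<phi>"
  shows "G \<infinity> = 0"
proof -
  obtain \<beta> :: "real \<Rightarrow> real" where \<beta>: "\<beta> \<in> test_functions" "(LINT y|lborel. \<beta> y) > 0"
    using bump_at[of 0] by blast
  define \<psi> where "\<psi> = (deriv ^^ j) \<beta>"
  have \<psi>: "\<psi> \<in> test_functions" unfolding \<psi>_def by (rule test_deriv_pow[OF \<beta>(1)])
  obtain C where "bounded_measurable (\<lambda>x. F (ereal x)) C" using B_r_bounded_measurable[OF F] .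
  from bounded_measurable.dist_of_fun_at_top[OF this test_deriv[OF \<psi>] B_r_tendsto(2)[OF F]]
  have "((\<lambda>s. dist_of_fun (\<lambda>x. F (ereal x)) (\<lambda>x. deriv \<psi> (x - s))) \<longlongrightarrow> 0) at_top"
    by (simp add: test_integral_deriv_eq_0[OF \<psi>])
  then have "((\<lambda>s. (-1) ^ Suc j * dist_of_fun (\<lambda>x. F (ereal x)) (\<lambda>x. deriv \<psi> (x - s))) \<longlongrightarrow> 0) at_top"
    by (rule tendsto_mult_right_zero)
  moreover have "(-1) ^ Suc j * dist_of_fun (\<lambda>x. F (ereal x)) (\<lambda>x. deriv \<psi> (x - s)) =
      dist_of_fun (\<lambda>x. G (ereal x)) (\<lambda>x. \<beta> (x - s))" for s
  proof -
    have t: "(\<lambda>x. \<beta> (x - s)) \<in> test_functions" using test_shift[OF \<beta>(1), of "- s"] by simp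
    have "(deriv ^^ Suc j) (\<lambda>x. \<beta> (x - s)) = (\<lambda>x. deriv \<psi> (x - s))"
      using deriv_pow_shift[OF \<beta>(1), of "Suc j" "- s"] by (simp add: \<psi>_def)
    then show ?thesis
      using bspec[OF eq t] dist_deriv_pow_apply[OF t, of "Suc j" "dist_of_fun (\<lambda>x. F (ereal x))"]
      unfolding nth_dist_deriv_def by simp
  qed
  ultimately have "((\<lambda>s. dist_of_fun (\<lambda>x. G (ereal x)) (\<lambda>x. \<beta> (x - s))) \<longlongrightarrow> 0) at_top" by simp
  moreover obtain C' where "bounded_measurable (\<lambda>x. G (ereal x)) C'" using B_r_bounded_measurable[OF G] .
  note bounded_measurable.dist_of_fun_at_top[OF this \<beta>(1) B_r_tendsto(2)[OF G]]
  ultimately have "G \<infinity> * (LINT y|lborel. \<beta> y) = 0"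
    using tendsto_unique[OF trivial_limit_at_top_linorder] by blast
  then show ?thesis using \<beta>(2) by simp
qed

section \<open>The Dirac distribution\<close>

text \<open>As the distribution function of the point mass at 0, it inherits membership in
  \<open>B_r\<close> and its derivative from the results on measures.\<close>

definition heaviside :: "ereal \<Rightarrow> real" where
  "heaviside = left_cdf (return borel 0)"

lemma finite_borel_measure_return: "finite_borel_measure (return borel a)"
proof -
  interpret prob_space "return borel a" by (rule prob_space_return) simp
  show ?thesis by unfold_locales simp
qed

lemma heaviside_simps [simp]:
  "heaviside (ereal x) = (if 0 < x then 1 else 0)"
  "heaviside \<infinity> = 1"
  by (simp_all add: heaviside_def measure_return indicator_def)

lemma heaviside_B_r: "heaviside \<in> B_r"
  unfolding heaviside_def by (rule finite_borel_measure.left_cdf_B_r[OF finite_borel_measure_return])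

lemma dirac_eq_heaviside: "dirac = dist_deriv (dist_of_fun (\<lambda>x. heaviside (ereal x)))"
proof (rule extensionalityI[of _ test_functions])
  fix \<phi> assume t: "\<phi> \<in> test_functions"
  then show "dirac \<phi> = dist_deriv (dist_of_fun (\<lambda>x. heaviside (ereal x))) \<phi>"
    unfolding heaviside_def
    by (simp add: finite_borel_measure.dist_deriv_left_cdf[OF finite_borel_measure_return t]
        integral_return test_measurable dirac_def del: left_cdf_simps)
qed (simp_all add: dirac_def dist_deriv_def)

lemma dist_deriv_pow_dirac: "(dist_deriv ^^ m) dirac = nth_dist_deriv (Suc m) heaviside"
  unfolding dirac_eq_heaviside nth_dist_deriv_def by (simp only: funpow_Suc_right comp_apply)

lemma dirac_distributions: "dirac \<in> distributions"
proof (rule distributionsI)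
  fix \<phi> \<psi>
  assume "\<And>j. \<phi> j \<in> test_functions" "\<psi> \<in> test_functions" and c: "test_converges \<phi> \<psi>"
  moreover have "uniform_limit UNIV (\<lambda>j. (deriv ^^ 0) (\<phi> j)) ((deriv ^^ 0) \<psi>) sequentially"
    using c unfolding test_converges_def by blast
  then have "(\<lambda>j. \<phi> j 0) \<longlonglongrightarrow> \<psi> 0" by (simp add: tendsto_uniform_limitI)
  ultimately show "(\<lambda>j. dirac (\<phi> j)) \<longlonglongrightarrow> dirac \<psi>" by (simp add: dirac_def)
qed (simp_all add: dirac_def linear_functional_def test_linear)

text \<open>On \<open>\<phi>(c x)\<close>, multiplied by \<open>c\<close>, the left side has size
  \<open>c ^ (i + 1) * |(deriv ^^ i) \<phi> 0|\<close> while the right side stays bounded. So the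
  \<open>i\<close>-th derivative of every test function vanishes at 0. Instead of constructing a
  counterexample for each \<open>i\<close>, this is read as the \<open>i\<close>-th derivative of
  \<open>dirac\<close> being 0; cancelling gives \<open>dirac = 0\<close>, which a bump
  refutes.\<close>

lemma dist_deriv_pow_dirac_ne_bounded:
  assumes F: "bounded_measurable F C"
    and eq: "\<forall>\<phi>\<in>test_functions. (dist_deriv ^^ i) dirac \<phi> = dist_of_fun F \<phi>"
  shows False
proof -
  have 0: "(deriv ^^ i) \<phi> 0 = 0" if t: "\<phi> \<in> test_functions" for \<phi>
  proof (rule ccontr)
    define a where "a = \<bar>(deriv ^^ i) \<phi> 0\<bar>"
    define K where "K = (LINT y|lborel. C * \<bar>\<phi> y\<bar>)"
    assume "(deriv ^^ i) \<phi> 0 \<noteq> 0"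
    then have a: "a > 0" by (simp add: a_def)
    \<comment> \<open>The second entry makes \<open>c * a\<close> exceed \<open>K\<close>; the first
      ensures \<open>c ^ i \<ge> 1\<close>.\<close>
    define c where "c = max 1 (K / a + 1)"
    have c: "c \<ge> 1" "c > 0" "c * a > K"
      using a by (auto simp: c_def field_simps max_def)
    have tc: "(\<lambda>x. \<phi> (c * x)) \<in> test_functions" using test_affine[OF t, of c 0] c by simp
    have "dist_of_fun F (\<lambda>x. \<phi> (c * x)) = (-1) ^ i * dirac ((deriv ^^ i) (\<lambda>x. \<phi> (c * x)))"
      using bspec[OF eq tc] dist_deriv_pow_apply[OF tc] by simp
    also have "\<dots> = (-1) ^ i * (c ^ i * (deriv ^^ i) \<phi> 0)"
      using test_deriv_pow[OF tc, of i] deriv_pow_affine[OF t, of i c 0] by (simp add: dirac_def)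
    finally have "\<bar>c * dist_of_fun F (\<lambda>x. \<phi> (c * x))\<bar> = c * (c ^ i * a)"
      using c by (simp add: a_def abs_mult power_abs)
    then have "c * (c ^ i * a) \<le> K"
      using bounded_measurable.dist_of_fun_scale_bound[OF F t c(2)] by (simp add: K_def)
    moreover have "1 * a \<le> c ^ i * a" using a c by (intro mult_right_mono) auto
    then have "c * a \<le> c * (c ^ i * a)" using c by (intro mult_left_mono) auto
    ultimately show False using c(3) by linarith
  qed
  \<comment> \<open>The zero distribution, presented through the zero function in \<open>B_r\<close>
    so that the cancellation of derivatives applies to it.\<close>
  define Z :: "(real \<Rightarrow> real) \<Rightarrow> real" where "Z = (\<lambda>\<phi>\<in>test_functions. 0)"
  have Z: "Z = dist_of_fun (\<lambda>x. (\<lambda>_. 0) (ereal x))" "(\<lambda>_. 0) \<in> B_r"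
    by (auto simp: Z_def dist_of_fun_def B_r_def regulated_def)
  have ext: "(dist_deriv ^^ i) T \<in> extensional test_functions" if "T \<in> extensional test_functions"
    for T using that by (cases i) (auto simp: dist_deriv_def)
  have "(dist_deriv ^^ i) dirac = (dist_deriv ^^ i) Z"
    by (rule extensionalityI[of _ test_functions])
      (auto intro!: ext simp: dirac_def Z_def dist_deriv_pow_apply 0 test_deriv_pow)
  then have "\<forall>\<phi>\<in>test_functions. dirac \<phi> = Z \<phi>"
    unfolding Z(1) dirac_eq_heaviside
    by (intro dist_deriv_pow_eq_imp_eq linear_functional_dist_deriv vanishes_at_bot_dist_deriv
        B_r_linear B_r_vanishes heaviside_B_r Z(2))
  moreover obtain \<beta> :: "real \<Rightarrow> real" where "\<beta> \<in> test_functions" "\<And>x. \<beta> x \<noteq> 0 \<longleftrightarrow> \<bar>x - 0\<bar> < 1"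
    using bump_at[of 0] by blast
  ultimately show False by (force simp: dirac_def Z_def)
qed

lemma dirac_pow_eq_imp:
  assumes F: "F \<in> B_r" and eq: "(dist_deriv ^^ m) dirac = nth_dist_deriv n F"
  shows "n = m + 1" "F = heaviside"
proof -
  \<comment> \<open>The orders are compared with \<open>m + 1\<close>, the order of
    \<open>heaviside\<close>; \<open>Suc j\<close> is the positive difference. In the first case
    \<open>j = m - n\<close> and \<open>F\<close> would equal the \<open>j\<close>-th derivative of
    \<open>dirac\<close>; in the last, \<open>heaviside\<close> would have limit 0 at
    infinity.\<close>
  consider j where "n + Suc j = m + 1" | "n = m + 1" | j where "n = (m + 1) + Suc j"
    by (metis add_Suc_right less_iff_Suc_add linorder_neqE_nat)
  then show "n = m + 1"
  proof cases
    case 1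
    then have "nth_dist_deriv (n + Suc j) heaviside = nth_dist_deriv n F"
      using eq by (simp add: dist_deriv_pow_dirac)
    from nth_dist_deriv_cancel[OF heaviside_B_r F this]
    have "\<forall>\<phi>\<in>test_functions. (dist_deriv ^^ j) dirac \<phi> = dist_of_fun (\<lambda>x. F (ereal x)) \<phi>"
      by (simp only: dist_deriv_pow_dirac)
    then show ?thesis
      using dist_deriv_pow_dirac_ne_bounded B_r_bounded_measurable[OF F] by metis
  next
    case 3
    then have "nth_dist_deriv ((m + 1) + Suc j) F = nth_dist_deriv (m + 1) heaviside"
      using eq by (simp add: dist_deriv_pow_dirac)
    from limit_eq_0_if_derivative[OF F heaviside_B_r nth_dist_deriv_cancel[OF F heaviside_B_r this]]
    show ?thesis by simp
  qed
  then show "F = heaviside"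
    using eq by (intro nth_dist_deriv_inj[OF F heaviside_B_r, of n]) (simp add: dist_deriv_pow_dirac)
qed

text \<open>The value at 0 is 0, but the right limit there is 1.\<close>

lemma heaviside_not_B_c: "heaviside \<notin> B_c"
proof
  assume "heaviside \<in> B_c"
  from B_c_tendsto(3)[OF this, of 0]
  have "((\<lambda>t. heaviside (ereal t)) \<longlongrightarrow> 0) (at_right 0)" by (simp add: filterlim_at_split)
  moreover have "((\<lambda>t. heaviside (ereal t)) \<longlongrightarrow> 1) (at_right 0)"
    by (rule tendsto_eventually) (use eventually_at_right_less[of 0] in \<open>auto elim: eventually_mono\<close>)
  ultimately have "(0::real) = 1" by (rule tendsto_unique[OF trivial_limit_at_right_real])
  then show False by simp
qed

lemma sup_norm_heaviside: "sup_norm heaviside = 1"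
  unfolding sup_norm_def by (rule cSup_eq_maximum) (auto intro: image_eqI[of _ _ 1])

section \<open>Measures\<close>

text \<open>The primitive is the difference of the distribution functions of the two Jordan parts,
  both of which are finite measures.\<close>

lemma dist_of_measure_primitive:
  assumes \<mu>: "finite_signed_borel_measure \<mu>"
  obtains F where "F \<in> B_r" "dist_of_measure \<mu> = dist_deriv (dist_of_fun (\<lambda>x. F (ereal x)))"
proof -
  define P N where "P = left_cdf (pos_part_measure \<mu>)" and "N = left_cdf (neg_part_measure \<mu>)"
  interpret P: finite_borel_measure "pos_part_measure \<mu>" by (rule finite_borel_measure_pos_part[OF \<mu>])
  interpret N: finite_borel_measure "neg_part_measure \<mu>" by (rule finite_borel_measure_neg_part[OF \<mu>])
  note bm = P.bounded_measurable_left_cdf N.bounded_measurable_left_cdf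
  show thesis
  proof (rule that)
    show "(\<lambda>x. P x - N x) \<in> B_r"
      unfolding P_def N_def by (intro B_r_diff P.left_cdf_B_r N.left_cdf_B_r)
    show "dist_of_measure \<mu> = dist_deriv (dist_of_fun (\<lambda>x. P (ereal x) - N (ereal x)))"
    proof (rule extensionalityI[of _ test_functions])
      fix \<phi> assume t: "\<phi> \<in> test_functions"
      have "dist_of_fun (\<lambda>x. P (ereal x) - N (ereal x)) (deriv \<phi>) =
          dist_of_fun (\<lambda>x. P (ereal x)) (deriv \<phi>) - dist_of_fun (\<lambda>x. N (ereal x)) (deriv \<phi>)"
        using bm[THEN bounded_measurable.integrable_mult_test, OF test_deriv[OF t]] test_deriv[OF t]
        by (simp add: dist_of_fun_def P_def N_def left_diff_distrib del: left_cdf_simps)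
      then show "dist_of_measure \<mu> \<phi> = dist_deriv (dist_of_fun (\<lambda>x. P (ereal x) - N (ereal x))) \<phi>"
        using t P.dist_deriv_left_cdf[OF t] N.dist_deriv_left_cdf[OF t]
        by (simp add: dist_deriv_apply dist_of_measure_def signed_integral_def P_def N_def
            del: left_cdf_simps)
    qed (simp_all add: dist_of_measure_def dist_deriv_def)
  qed
qed

lemma dist_of_measure_distributions:
  assumes \<mu>: "finite_signed_borel_measure \<mu>"
  shows "dist_of_measure \<mu> \<in> distributions"
proof (rule distributionsI)
  interpret P: finite_borel_measure "pos_part_measure \<mu>" by (rule finite_borel_measure_pos_part[OF \<mu>])
  interpret N: finite_borel_measure "neg_part_measure \<mu>" by (rule finite_borel_measure_neg_part[OF \<mu>])
  show "linear_functional (dist_of_measure \<mu>)"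
    by (simp add: linear_functional_def dist_of_measure_def signed_integral_def test_linear
        P.test_integrable_measure N.test_integrable_measure algebra_simps)
  fix \<phi> \<psi>
  assume t: "\<And>j. \<phi> j \<in> test_functions" "\<psi> \<in> test_functions" and c: "test_converges \<phi> \<psi>"
  have "uniform_limit UNIV (\<lambda>j. (deriv ^^ 0) (\<phi> j)) ((deriv ^^ 0) \<psi>) sequentially"
    using c unfolding test_converges_def by blast
  then have "uniform_limit UNIV \<phi> \<psi> sequentially" by simp
  then have "(\<lambda>j. signed_integral \<mu> (\<phi> j)) \<longlonglongrightarrow> signed_integral \<mu> \<psi>"
    unfolding signed_integral_def
    by (intro tendsto_diff P.integral_uniform_limit N.integral_uniform_limit t)
  then show "(\<lambda>j. dist_of_measure \<mu> (\<phi> j)) \<longlonglongrightarrow> dist_of_measure \<mu> \<psi>"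
    using t by (simp add: dist_of_measure_def)
qed (simp add: dist_of_measure_def)

theorem proposition12:
  fixes m :: nat
  shows "(\<forall>n\<ge>1. (dist_deriv ^^ m) dirac \<in> A_r n \<longleftrightarrow> n = m + 1) \<and>
         (\<forall>n\<ge>1. (dist_deriv ^^ m) dirac \<notin> A_c n) \<and>
         norm_a (m + 1) ((dist_deriv ^^ m) dirac) = 1 \<and>
         (\<forall>\<mu>. finite_signed_borel_measure \<mu> \<longrightarrow>
            (dist_deriv ^^ m) (dist_of_measure \<mu>) \<in> A_r (m + 1))"
proof (intro conjI allI impI)
  fix n
  show "(dist_deriv ^^ m) dirac \<in> A_r n \<longleftrightarrow> n = m + 1"
  proof
    assume "(dist_deriv ^^ m) dirac \<in> A_r n"
    then show "n = m + 1" unfolding A_r_def using dirac_pow_eq_imp(1) by blast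
  next
    assume "n = m + 1"
    then show "(dist_deriv ^^ m) dirac \<in> A_r n"
      using dist_deriv_pow_distributions[OF dirac_distributions, of m] heaviside_B_r
      unfolding A_r_def by (auto simp: dist_deriv_pow_dirac)
  qed
  \<comment> \<open>A primitive in \<open>B_c\<close> would also lie in \<open>B_r\<close>, hence be
    \<open>heaviside\<close>, which jumps.\<close>
  show "(dist_deriv ^^ m) dirac \<notin> A_c n"
    unfolding A_c_def using dirac_pow_eq_imp(2) heaviside_not_B_c B_c_subset_B_r by blast
next
  \<comment> \<open>The description \<open>THE\<close> is resolved by the uniqueness half of
    \<open>dirac_pow_eq_imp\<close>.\<close>
  have "primitive (m + 1) ((dist_deriv ^^ m) dirac) = heaviside"
    unfolding primitive_def
    by (rule the_equality)
      (use heaviside_B_r dirac_pow_eq_imp(2) in \<open>auto simp: dist_deriv_pow_dirac\<close>)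
  then show "norm_a (m + 1) ((dist_deriv ^^ m) dirac) = 1"
    by (simp add: norm_a_def sup_norm_heaviside)
next
  fix \<mu> assume \<mu>: "finite_signed_borel_measure \<mu>"
  obtain F where F: "F \<in> B_r" "dist_of_measure \<mu> = dist_deriv (dist_of_fun (\<lambda>x. F (ereal x)))"
    using dist_of_measure_primitive[OF \<mu>] .
  have "(dist_deriv ^^ m) (dist_of_measure \<mu>) = nth_dist_deriv (m + 1) F"
    unfolding F(2) nth_dist_deriv_def by (simp only: Suc_eq_plus1[symmetric] funpow_Suc_right comp_apply)
  then show "(dist_deriv ^^ m) (dist_of_measure \<mu>) \<in> A_r (m + 1)"
    using F(1) dist_deriv_pow_distributions[OF dist_of_measure_distributions[OF \<mu>], of m]
    unfolding A_r_def by blast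
qed

end
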